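(* Let $x\cdot y$ be a PA-structure on $(\mathfrak{g},\mathfrak{n})$, where $\mathfrak{g}$ is a nilpotent Lie algebra and $H^0(\mathfrak{g},\mathfrak{n})=\{y\in V\mid x\cdot y=0\ \forall x\in V\}=0$. Let $X$ be the (finite) set of weights of the $\mathfrak{g}$-module $\mathfrak{n}$ (with action $x\mapsto L(x)$), i.e. after extending scalars to an algebraic closure $\overline{K}$, the set of linear forms $\alpha\in(\mathfrak{g}\otimes\overline{K})^*$ whose generalized weight space $\mathfrak{n}_\alpha=\{v\mid \forall x\ \exists k:\ (L(x)-\alpha(x))^k v=0\}$ is nonzero. Then $\mathfrak{n}$ is nilpotent of nilpotency class at most $|X|^{2^{|X|}}$.
   Context: Let $K$ be a field of characteristic zero and $V$ a finite-dimensional vector space over $K$. Let $\mathfrak{g}=(V,[\,,])$ and $\mathfrak{n}=(V,\{\,,\})$ be two Lie algebra structures on $V$. A post-Lie algebra structure (PA-structure) on the pair $(\mathfrak{g},\mathfrak{n})$ is a $K$-bilinear product $x\cdot y$ on $V$ satisfying, for all $x,y,z\in V$: (i) $x\cdot y-y\cdot x=[x,y]-\{x,y\}$; (ii) $[x,y]\cdot z=x\cdot(y\cdot z)-y\cdot(x\cdot z)$; (iii) $x\cdot\{y,z\}=\{x\cdot y,z\}+\{y,x\cdot z\}$. Write $L(x)(y)=x\cdot y$. By (ii) and (iii), $L:\mathfrak{g}\to\mathrm{Der}(\mathfrak{n})$ is a Lie algebra representation. *)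

theory Defs
  imports "HOL-Algebra.Algebraic_Closure_Type"
begin

text \<open>Coordinates: V = K^n is modelled as the function space 'n \<Rightarrow> 'a with 'n finite.
  Vector operations are written out componentwise.\<close>

definition vadd :: "('n \<Rightarrow> 'a::field) \<Rightarrow> ('n \<Rightarrow> 'a) \<Rightarrow> ('n \<Rightarrow> 'a)" where
  "vadd u v = (\<lambda>i. u i + v i)"

definition vscale :: "'a::field \<Rightarrow> ('n \<Rightarrow> 'a) \<Rightarrow> ('n \<Rightarrow> 'a)" where
  "vscale c v = (\<lambda>i. c * v i)"

definition vzero :: "'n \<Rightarrow> 'a::field" where
  "vzero = (\<lambda>i. 0)"

definition bilinear_op :: "(('n \<Rightarrow> 'a::field) \<Rightarrow> ('n \<Rightarrow> 'a) \<Rightarrow> ('n \<Rightarrow> 'a)) \<Rightarrow> bool" where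
  "bilinear_op B \<longleftrightarrow>
     (\<forall>u v w. B (vadd u v) w = vadd (B u w) (B v w)) \<and>
     (\<forall>u v w. B u (vadd v w) = vadd (B u v) (B u w)) \<and>
     (\<forall>c u w. B (vscale c u) w = vscale c (B u w)) \<and>
     (\<forall>c u w. B u (vscale c w) = vscale c (B u w))"

definition lie_algebra :: "(('n \<Rightarrow> 'a::field) \<Rightarrow> ('n \<Rightarrow> 'a) \<Rightarrow> ('n \<Rightarrow> 'a)) \<Rightarrow> bool" where
  "lie_algebra B \<longleftrightarrow> bilinear_op B \<and> (\<forall>x. B x x = vzero) \<and>
     (\<forall>x y z. vadd (B x (B y z)) (vadd (B y (B z x)) (B z (B x y))) = vzero)"

definition lsubspace :: "('n \<Rightarrow> 'a::field) set \<Rightarrow> bool" where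
  "lsubspace W \<longleftrightarrow> vzero \<in> W \<and> (\<forall>u\<in>W. \<forall>v\<in>W. vadd u v \<in> W) \<and> (\<forall>c. \<forall>u\<in>W. vscale c u \<in> W)"

definition lspan :: "('n \<Rightarrow> 'a::field) set \<Rightarrow> ('n \<Rightarrow> 'a) set" where
  "lspan S = \<Inter>{W. lsubspace W \<and> S \<subseteq> W}"

text \<open>Lower central series, shifted by one: lcs B 0 = V = n^1, lcs B k = n^(k+1),
  with n^(k+1) = span {[x,y] | x \<in> V, y \<in> n^k}.\<close>
fun lcs :: "(('n \<Rightarrow> 'a::field) \<Rightarrow> ('n \<Rightarrow> 'a) \<Rightarrow> ('n \<Rightarrow> 'a)) \<Rightarrow> nat \<Rightarrow> ('n \<Rightarrow> 'a) set" where
  "lcs B 0 = UNIV"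
| "lcs B (Suc k) = lspan {B x y | x y. y \<in> lcs B k}"

definition nilpotent_lie :: "(('n \<Rightarrow> 'a::field) \<Rightarrow> ('n \<Rightarrow> 'a) \<Rightarrow> ('n \<Rightarrow> 'a)) \<Rightarrow> bool" where
  "nilpotent_lie B \<longleftrightarrow> (\<exists>c. lcs B c = {vzero})"

definition nilpotency_class_le :: "(('n \<Rightarrow> 'a::field) \<Rightarrow> ('n \<Rightarrow> 'a) \<Rightarrow> ('n \<Rightarrow> 'a)) \<Rightarrow> nat \<Rightarrow> bool" where
  "nilpotency_class_le B c \<longleftrightarrow> lcs B c = {vzero}"

definition vdiff :: "('n \<Rightarrow> 'a::field) \<Rightarrow> ('n \<Rightarrow> 'a) \<Rightarrow> ('n \<Rightarrow> 'a)" where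
  "vdiff u v = (\<lambda>i. u i - v i)"

definition post_lie_structure ::
  "(('n \<Rightarrow> 'a::field) \<Rightarrow> ('n \<Rightarrow> 'a) \<Rightarrow> ('n \<Rightarrow> 'a)) \<Rightarrow> (('n \<Rightarrow> 'a) \<Rightarrow> ('n \<Rightarrow> 'a) \<Rightarrow> ('n \<Rightarrow> 'a))
     \<Rightarrow> (('n \<Rightarrow> 'a) \<Rightarrow> ('n \<Rightarrow> 'a) \<Rightarrow> ('n \<Rightarrow> 'a)) \<Rightarrow> bool" where
  "post_lie_structure G N P \<longleftrightarrow> bilinear_op P \<and>
     (\<forall>x y. vdiff (P x y) (P y x) = vdiff (G x y) (N x y)) \<and>
     (\<forall>x y z. P (G x y) z = vdiff (P x (P y z)) (P y (P x z))) \<and>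
     (\<forall>x y z. P x (N y z) = vadd (N (P x y) z) (N y (P x z)))"

definition H0 :: "(('n \<Rightarrow> 'a::field) \<Rightarrow> ('n \<Rightarrow> 'a) \<Rightarrow> ('n \<Rightarrow> 'a)) \<Rightarrow> ('n \<Rightarrow> 'a) set" where
  "H0 P = {y. \<forall>x. P x y = vzero}"

text \<open>Extension of scalars to the algebraic closure: the bilinear product P extended
  to K-bar^n via its structure constants on the standard basis.\<close>
definition basis_vec :: "'n \<Rightarrow> 'n \<Rightarrow> 'a::field" where
  "basis_vec i = (\<lambda>k. if k = i then 1 else 0)"

definition ext_prod :: "(('n::finite \<Rightarrow> 'a::field) \<Rightarrow> ('n \<Rightarrow> 'a) \<Rightarrow> ('n \<Rightarrow> 'a))
     \<Rightarrow> ('n \<Rightarrow> 'a alg_closure) \<Rightarrow> ('n \<Rightarrow> 'a alg_closure) \<Rightarrow> ('n \<Rightarrow> 'a alg_closure)" where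
  "ext_prod P x v = (\<lambda>k. \<Sum>i\<in>UNIV. \<Sum>j\<in>UNIV. x i * v j * to_ac (P (basis_vec i) (basis_vec j) k))"

text \<open>A linear form alpha on g \<otimes> K-bar is given by its values on the standard basis.\<close>
definition lin_form_app :: "('n::finite \<Rightarrow> 'a::field alg_closure) \<Rightarrow> ('n \<Rightarrow> 'a alg_closure) \<Rightarrow> 'a alg_closure" where
  "lin_form_app \<alpha> x = (\<Sum>i\<in>UNIV. \<alpha> i * x i)"

definition gen_weight_space :: "(('n::finite \<Rightarrow> 'a::field) \<Rightarrow> ('n \<Rightarrow> 'a) \<Rightarrow> ('n \<Rightarrow> 'a))
     \<Rightarrow> ('n \<Rightarrow> 'a alg_closure) \<Rightarrow> ('n \<Rightarrow> 'a alg_closure) set" where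
  "gen_weight_space P \<alpha> = {v. \<forall>x. \<exists>k.
      ((\<lambda>w. (\<lambda>i. ext_prod P x w i - lin_form_app \<alpha> x * w i)) ^^ k) v = (\<lambda>i. 0)}"

definition weights :: "(('n::finite \<Rightarrow> 'a::field) \<Rightarrow> ('n \<Rightarrow> 'a) \<Rightarrow> ('n \<Rightarrow> 'a))
     \<Rightarrow> ('n \<Rightarrow> 'a alg_closure) set" where
  "weights P = {\<alpha>. gen_weight_space P \<alpha> \<noteq> {(\<lambda>i. 0)}}"

end

theory Submission
  imports Defs "HOL-Library.Function_Algebras"
begin

text \<open>Over the algebraic closure, \<open>n\<close> is the sum of its generalized weight spaces, the weight
  spaces multiply additively, and \<open>0\<close> is not a weight: a nonzero \<open>n\<^sub>0\<close> would contain a common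
  eigenvector, necessarily a null vector. So \<open>n\<close> is graded by a torsion-free group with finite
  support \<open>Y\<close> not containing \<open>0\<close>. An additive map to the rationals orders \<open>Y\<close>, and eliminating
  the weights one at a time (Kreknin's argument: each elimination doubles the derived length)
  gives derived length less than \<open>2 ^ |Y|\<close>. Finally, \<open>|Y|\<close> commuting homogeneous operators of nonzero
  weight have product zero on a space supported in \<open>Y\<close>; induction along the derived series
  multiplies the length of vanishing products by \<open>|Y|\<close> at each step.\<close>

section \<open>Solvability of graded Lie algebras\<close>

text \<open>The absence of weight 0 acts twice. In a product of weight \<open>c\<close>, a factor of
  weight \<open>c\<close> would leave weight 0 to the rest, so elimination never meets one. And
  every homogeneous operator strictly raises or lowers a rational functional \<open>\<phi>\<close>,
  so a chain of raisings (or of lowerings) cannot repeat a weight. Both arguments count weights,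
  never dimensions; hence a bound in |X| alone. The obstacle between the two halves: solvable does
  not mean nilpotent, and homogeneous operators commute only modulo the derived algebra. The remedy
  is to filter the whole algebra by repeated multiplication by the derived algebra. On the layers
  the operators do commute, |X| of them descend one layer, and induction bounds the number of
  layers. This makes |X| the base and the derived length the exponent. Nilpotency of the acting
  algebra supplies common eigenvectors and makes the generalized weight spaces invariant.\<close>

locale lie_bracket = vector_space scale
  for scale :: "'k::field \<Rightarrow> 'v::ab_group_add \<Rightarrow> 'v" +
  fixes br :: "'v \<Rightarrow> 'v \<Rightarrow> 'v"
  assumes br_add_left: "br (x + y) z = br x z + br y z"
    and br_add_right: "br x (y + z) = br x y + br x z"
    and br_scale_left: "br (scale c x) y = scale c (br x y)"
    and br_scale_right: "br x (scale c y) = scale c (br x y)"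
    and br_skew: "br x y = - br y x"
    and br_jacobi: "br x (br y z) = br (br x y) z + br y (br x z)"
begin

lemma br_0_left [simp]: "br 0 x = 0"
  using br_add_left[of 0 0 x] by simp

lemma br_0_right [simp]: "br x 0 = 0"
  using br_add_right[of x 0 0] by simp

lemma br_diff_right: "br x (y - z) = br x y - br x z"
  by (metis add_diff_cancel_right' br_add_right diff_add_cancel)

lemma br_diff_left: "br (x - y) z = br x z - br y z"
  by (metis add_diff_cancel_right' br_add_left diff_add_cancel)

lemma br_span_left:
  assumes "x \<in> span A" "subspace S" "\<And>a. a \<in> A \<Longrightarrow> br a y \<in> S"
  shows "br x y \<in> S"
  using assms(1) by (rule span_induct)
    (use assms(2,3) in \<open>auto simp: br_add_left br_scale_left subspace_def\<close>)

lemma br_span_right: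
  assumes "y \<in> span A" "subspace S" "\<And>a. a \<in> A \<Longrightarrow> br x a \<in> S"
  shows "br x y \<in> S"
  using assms(1) by (rule span_induct)
    (use assms(2,3) in \<open>auto simp: br_add_right br_scale_right subspace_def\<close>)

definition graded_subalgebra :: "('w::ab_group_add \<Rightarrow> 'v set) \<Rightarrow> bool" where
  "graded_subalgebra F \<longleftrightarrow>
     (\<forall>a. subspace (F a)) \<and> (\<forall>a b. \<forall>u\<in>F a. \<forall>v\<in>F b. br u v \<in> F (a + b))"

lemma graded_subalgebraD:
  assumes "graded_subalgebra F"
  shows "subspace (F a)" "\<lbrakk>u \<in> F a; v \<in> F b\<rbrakk> \<Longrightarrow> br u v \<in> F (a + b)"
  using assms by (auto simp: graded_subalgebra_def)

text \<open>Two families are allowed because the product forms not only the derived series but also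
  the filtration by multiples of a derived algebra.\<close>

definition graded_product ::
  "('w::ab_group_add \<Rightarrow> 'v set) \<Rightarrow> ('w \<Rightarrow> 'v set) \<Rightarrow> 'w \<Rightarrow> 'v set" where
  "graded_product E F a = span {br u v |u v b c. u \<in> E b \<and> v \<in> F c \<and> b + c = a}"

abbreviation derived :: "('w::ab_group_add \<Rightarrow> 'v set) \<Rightarrow> 'w \<Rightarrow> 'v set" where
  "derived F \<equiv> graded_product F F"

lemma graded_productI: "u \<in> E b \<Longrightarrow> v \<in> F c \<Longrightarrow> br u v \<in> graded_product E F (b + c)"
  unfolding graded_product_def by (rule span_base) blast

lemma graded_product_least:
  assumes "subspace S" "\<And>u v b c. \<lbrakk>u \<in> E b; v \<in> F c; b + c = a\<rbrakk> \<Longrightarrow> br u v \<in> S"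
  shows "graded_product E F a \<subseteq> S"
  unfolding graded_product_def by (rule span_minimal) (use assms in auto)

lemma derived_subset: "graded_subalgebra F \<Longrightarrow> derived F a \<subseteq> F a"
  by (rule graded_product_least) (auto simp: graded_subalgebra_def)

lemma graded_subalgebra_derived:
  assumes "graded_subalgebra F"
  shows "graded_subalgebra (derived F)"
  unfolding graded_subalgebra_def
proof (intro conjI allI ballI)
  show "subspace (derived F a)" for a
    by (simp add: graded_product_def)
  show "br u v \<in> derived F (a + b)" if "u \<in> derived F a" "v \<in> derived F b" for a b u v
    using that derived_subset[OF assms] by (blast intro: graded_productI)
qed

lemma graded_subalgebra_derived_pow:
  "graded_subalgebra F \<Longrightarrow> graded_subalgebra ((derived ^^ m) F)"
  by (induction m) (auto intro: graded_subalgebra_derived)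

lemma derived_pow_subset: "graded_subalgebra F \<Longrightarrow> (derived ^^ m) F a \<subseteq> F a"
proof (induction m)
  case (Suc m)
  then show ?case
    using derived_subset[OF graded_subalgebra_derived_pow[OF Suc.prems, of m]] by force
qed simp

text \<open>The subalgebra generated by the components with weight outside \<open>R\<close>, with
  weights recorded. Only left-normed products are built in; closure under the bracket follows from
  Jacobi. Elimination enlarges \<open>R\<close> until no nonzero generator remains.\<close>

inductive gen :: "('w::ab_group_add \<Rightarrow> 'v set) \<Rightarrow> 'w set \<Rightarrow> 'w \<Rightarrow> 'v \<Rightarrow> bool"
  for F R where
  gen_base: "\<lbrakk>v \<in> F a; a \<notin> R\<rbrakk> \<Longrightarrow> gen F R a v"
| gen_step: "\<lbrakk>gen F R a u; v \<in> F b; b \<notin> R\<rbrakk> \<Longrightarrow> gen F R (a + b) (br u v)"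
| gen_zero: "gen F R a 0"
| gen_add: "\<lbrakk>gen F R a u; gen F R a v\<rbrakk> \<Longrightarrow> gen F R a (u + v)"
| gen_scale: "gen F R a u \<Longrightarrow> gen F R a (scale c u)"

lemma subspace_gen: "subspace (Collect (gen F R a))"
  by (auto simp: subspace_def intro: gen.intros)

text \<open>Products of at least two generators whose last factor is a single generator, so that its
  weight can be compared with the total weight.\<close>

definition decomposable :: "('w::ab_group_add \<Rightarrow> 'v set) \<Rightarrow> 'w set \<Rightarrow> 'w \<Rightarrow> 'v set" where
  "decomposable F R a = span {br u v |u v b c. gen F R b u \<and> v \<in> F c \<and> c \<notin> R \<and> b + c = a}"

lemma decomposable_subset: "decomposable F R a \<subseteq> Collect (gen F R a)"
  unfolding decomposable_def by (rule span_minimal[OF _ subspace_gen]) (auto intro: gen_step)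

lemma decomposableI:
  "\<lbrakk>gen F R b u; v \<in> F c; c \<notin> R\<rbrakk> \<Longrightarrow> br u v \<in> decomposable F R (b + c)"
  unfolding decomposable_def by (rule span_base) blast

text \<open>Jacobi gives u(wv) = (uw)v - (uv)w, where \<open>w\<close> is shorter than the second
  factor \<open>wv\<close>; hence induction on the second factor with an arbitrary first
  one.\<close>

lemma br_gen_decomposable:
  assumes "gen F R b w" "gen F R a u"
  shows "br u w \<in> decomposable F R (a + b)"
  using assms
proof (induction arbitrary: a u)
  case (gen_base v b)
  then show ?case by (blast intro: decomposableI)
next
  case (gen_step b w v c)
  have 1: "gen F R (a + b) (br u w)"
    using gen_step.IH[OF gen_step.prems] decomposable_subset by blast
  have 2: "gen F R (a + c) (br u v)"
    using gen.gen_step[OF gen_step.prems] gen_step.hyps by blast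
  have "br u (br w v) = br (br u w) v - br (br u v) w"
    using br_jacobi[of u w v] br_skew[of w "br u v"] by simp
  moreover have "br (br u w) v \<in> decomposable F R (a + b + c)"
    using 1 gen_step.hyps by (blast intro: decomposableI)
  moreover have "br (br u v) w \<in> decomposable F R (a + c + b)"
    using gen_step.IH[OF 2] .
  ultimately show ?case
    by (simp add: decomposable_def span_diff ac_simps)
qed (auto simp: br_add_right br_scale_right decomposable_def
     intro: span_zero span_add span_scale)

lemma gen_br: "\<lbrakk>gen F R a u; gen F R b v\<rbrakk> \<Longrightarrow> gen F R (a + b) (br u v)"
  using br_gen_decomposable decomposable_subset by blast

lemma gen_subset:
  assumes "graded_subalgebra F" "gen F R a u"
  shows "u \<in> F a"
  using assms(2) by induction
    (use assms(1) in \<open>auto simp: graded_subalgebra_def subspace_0 subspace_add subspace_scale\<close>)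

lemma gen_trans:
  assumes "gen M R a u" "\<And>b v. \<lbrakk>v \<in> M b; b \<notin> R\<rbrakk> \<Longrightarrow> gen F S b v"
  shows "gen F S a u"
  using assms(1) by induction (auto intro: gen.intros gen_br assms(2))

text \<open>The step of Kreknin's argument that uses the order: in a product of weight \<open>c\<close>
  whose last factor lies strictly beyond \<open>c\<close>, the remaining factors together do as well.\<close>

lemma derived_gen_top:
  fixes key :: "'w::ab_group_add \<Rightarrow> 'o::linorder"
  assumes F: "graded_subalgebra F" and supp: "\<And>a. a \<notin> Y \<Longrightarrow> F a = {0}"
    and Y: "0 \<notin> Y" "inj_on key Y"
    and key: "\<And>a b. \<lbrakk>a \<in> Y; b \<in> Y; a + b \<in> Y; key (a + b) < key b\<rbrakk> \<Longrightarrow> key (a + b) < key a"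
    and R: "insert c R \<subseteq> Y" "\<And>x. x \<in> R \<Longrightarrow> key x < key c"
       "\<And>x. \<lbrakk>x \<in> Y; key x < key c\<rbrakk> \<Longrightarrow> x \<in> R"
    and u: "u \<in> decomposable F R c"
  shows "gen F (insert c R) c u"
proof -
  have "decomposable F R c \<subseteq> Collect (gen F (insert c R) c)"
    unfolding decomposable_def
  proof (rule span_minimal[OF _ subspace_gen], rule subsetI)
    fix w
    assume "w \<in> {br u v |u v a b. gen F R a u \<and> v \<in> F b \<and> b \<notin> R \<and> a + b = c}"
    then obtain u v a b where w: "w = br u v"
      and uv: "gen F R a u" "v \<in> F b" "b \<notin> R" "a + b = c"
      by blast
    have uF: "u \<in> F a" using gen_subset[OF F] uv by blast
    show "w \<in> Collect (gen F (insert c R) c)"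
    proof (cases "u = 0 \<or> v = 0")
      case True
      then show ?thesis by (auto simp: w intro: gen_zero)
    next
      case False
      have "a \<in> Y" "b \<in> Y" using False uF uv supp by blast+
      \<comment> \<open>With \<open>b = c\<close> the other factor would have weight 0, which is
        outside the support.\<close>
      have "b \<noteq> c" using uv(4) Y(1) \<open>a \<in> Y\<close> by auto
      have "key c < key b"
        using uv(3) R(1,3) \<open>b \<in> Y\<close> \<open>b \<noteq> c\<close> Y(2) by (metis inj_onD insert_subset not_less_iff_gr_or_eq)
      then have "key c < key a"
        using key[OF \<open>a \<in> Y\<close> \<open>b \<in> Y\<close>] uv(4) R(1) by simp
      then have "a \<notin> insert c R" "b \<notin> insert c R"
        using R(2)[of a] R(2)[of b] \<open>key c < key b\<close> by auto
      then have "gen F (insert c R) (a + b) (br u v)"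
        using uv(2) uF by (intro gen_step gen_base)
      then show ?thesis
        using uv(4) w by simp
    qed
  qed
  then show ?thesis using u by blast
qed

text \<open>\<open>R\<close> is an initial segment of the order. Adding a new greatest element
  \<open>c\<close> costs one run of the previous elimination, one bracket that makes component
  \<open>c\<close> decomposable, and a second run inside the derived term so reached: (2^k - 1) + 1
  + (2^k - 1) = 2^(k+1) - 1.\<close>

lemma derived_pow_gen:
  fixes key :: "'w::ab_group_add \<Rightarrow> 'o::linorder"
  assumes Y: "finite Y" "0 \<notin> Y" "inj_on key Y"
    and key: "\<And>a b. \<lbrakk>a \<in> Y; b \<in> Y; a + b \<in> Y; key (a + b) < key b\<rbrakk> \<Longrightarrow> key (a + b) < key a"
    and "graded_subalgebra F" "\<And>a. a \<notin> Y \<Longrightarrow> F a = {0}"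
    and "R \<subseteq> Y" "\<And>x y. \<lbrakk>x \<in> R; y \<in> Y; key y < key x\<rbrakk> \<Longrightarrow> y \<in> R"
    and "u \<in> (derived ^^ (2 ^ card R - 1)) F a"
  shows "gen F R a u"
  using assms(5-)
proof (induction "card R" arbitrary: F R a u)
  case 0
  then have "R = {}" using Y(1) finite_subset by fastforce
  then show ?case using 0 by (auto intro: gen_base)
next
  case (Suc k)
  note F = Suc.prems(1) and supp = Suc.prems(2)
  have fin: "finite R" using Suc.prems(3) Y(1) finite_subset by blast
  have "R \<noteq> {}" using Suc.hyps(2) by auto
  then have "Max (key ` R) \<in> key ` R"
    using fin by simp
  then obtain c where "c \<in> R" "Max (key ` R) = key c"
    by blast
  then have c: "c \<in> R" "\<And>x. x \<in> R \<Longrightarrow> key x \<le> key c"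
    using Max_ge[of "key ` R"] fin by (simp, metis finite_imageI imageI)
  define R' where "R' = R - {c}"
  have R: "R = insert c R'" using c(1) by (auto simp: R'_def)
  have R'less: "key x < key c" if "x \<in> R'" for x
    using that c Y(3) Suc.prems(3) by (metis R'_def DiffE inj_onD insertI1 order_less_le subsetD)
  have R'mem: "x \<in> R'" if "x \<in> Y" "key x < key c" for x
    using that Suc.prems(4) c(1) by (auto simp: R'_def)
  have card: "k = card R'" using Suc.hyps(2) fin R'_def c(1) by simp
  have R'sub: "R' \<subseteq> Y" using Suc.prems(3) by (auto simp: R'_def)
  define M where "M = (derived ^^ (2 ^ k)) F"
  have M: "graded_subalgebra M" "M b \<subseteq> F b" for b
    using graded_subalgebra_derived_pow[OF F] derived_pow_subset[OF F] by (auto simp: M_def)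
  have Msupp: "M b = {0}" if "b \<notin> Y" for b
    using supp[OF that] M(2)[of b] subspace_0[OF graded_subalgebraD(1)[OF M(1)]] by blast
  have IH: "gen F' R' b v"
    if "graded_subalgebra F'" "\<And>a. a \<notin> Y \<Longrightarrow> F' a = {0}" "v \<in> (derived ^^ (2 ^ k - 1)) F' b"
    for F' :: "'w \<Rightarrow> 'v set" and b v
  proof (rule Suc.hyps(1)[OF card that(1,2) R'sub])
    show "y \<in> R'" if "x \<in> R'" "y \<in> Y" "key y < key x" for x y
      using that R'less R'mem by (meson less_trans)
  qed (use that(3) card in auto)
  \<comment> \<open>Elements of \<open>M c\<close> are sums of brackets of elements generated
    outside \<open>R'\<close>, hence decomposable; \<open>derived_gen_top\<close> then rewrites them
    with generators that avoid \<open>c\<close> as well.\<close>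
  have gen_c: "gen F R c v" if "v \<in> M c" for v
  proof -
    have "(derived ^^ Suc n) F = derived ((derived ^^ n) F)" for n
      by simp
    from this[of "2 ^ k - 1"] have "M = derived ((derived ^^ (2 ^ k - 1)) F)"
      by (simp add: M_def del: funpow.simps)
    moreover have "derived ((derived ^^ (2 ^ k - 1)) F) c \<subseteq> decomposable F R' c"
    proof (rule graded_product_least)
      show "subspace (decomposable F R' c)" by (simp add: decomposable_def)
      show "br u v \<in> decomposable F R' c"
        if "u \<in> (derived ^^ (2 ^ k - 1)) F a" "v \<in> (derived ^^ (2 ^ k - 1)) F b" "a + b = c"
        for u v a b
        using br_gen_decomposable[OF IH[OF F supp that(2)] IH[OF F supp that(1)]] that(3) by simp
    qed
    ultimately have "v \<in> decomposable F R' c" using that by blast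
    then show ?thesis
      unfolding R using Suc.prems(3) R
      by (intro derived_gen_top[OF F supp Y(2,3) key _ R'less R'mem]) auto
  qed
  have "gen F R b v" if "v \<in> M b" "b \<notin> R'" for b v
    using gen_c[of v] that M(2)[of b] R by (cases "b = c") (auto intro: gen_base)
  \<comment> \<open>Second run, with \<open>M\<close> as the graded algebra: its generators outside
    \<open>R'\<close> are already generated by those of \<open>F\<close> outside
    \<open>R\<close>.\<close>
  moreover have "gen M R' a u"
  proof (rule IH[OF M(1) Msupp])
    have "2 ^ card R - 1 = (2 ^ k - 1) + (2 ^ k :: nat)"
      using Suc.hyps(2)[symmetric] by simp
    then show "u \<in> (derived ^^ (2 ^ k - 1)) M a"
      using Suc.prems(5) unfolding M_def by (simp only: funpow_add o_apply)
  qed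
  ultimately show ?case by (blast intro: gen_trans)
qed

text \<open>The case \<open>R = Y\<close>: the remaining generators lie outside the support and are
  all zero.\<close>

theorem derived_pow_trivial:
  fixes key :: "'w::ab_group_add \<Rightarrow> 'o::linorder"
  assumes Y: "finite Y" "0 \<notin> Y" "inj_on key Y"
    and key: "\<And>a b. \<lbrakk>a \<in> Y; b \<in> Y; a + b \<in> Y; key (a + b) < key b\<rbrakk> \<Longrightarrow> key (a + b) < key a"
    and F: "graded_subalgebra F" and supp: "\<And>a. a \<notin> Y \<Longrightarrow> F a = {0}"
  shows "(derived ^^ (2 ^ card Y - 1)) F a = {0}"
proof -
  have "u = 0" if "gen F Y b u" for b u
    using that by induction (use supp in auto)
  moreover have "gen F Y a u" if "u \<in> (derived ^^ (2 ^ card Y - 1)) F a" for u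
    by (rule derived_pow_gen[OF Y key F supp order_refl _ that])
  ultimately have "(derived ^^ (2 ^ card Y - 1)) F a \<subseteq> {0}"
    by blast
  then show ?thesis
    using subspace_0[OF graded_subalgebraD(1)[OF graded_subalgebra_derived_pow[OF F]]] by blast
qed

subsection \<open>From solvability to nilpotency\<close>

lemma foldr_br_linear:
  "foldr br es (u + v) = foldr br es u + foldr br es v"
  "foldr br es (scale c v) = scale c (foldr br es v)"
  by (induction es) (simp_all add: br_add_right br_scale_right)

lemma foldr_br_0 [simp]: "foldr br es 0 = 0"
  by (induction es) simp_all

lemma foldr_br_zero_mem: "0 \<in> set es \<Longrightarrow> foldr br es v = 0"
  by (induction es) auto

lemma foldr_br_span:
  assumes "v \<in> span A" "subspace S" "\<And>a. a \<in> A \<Longrightarrow> foldr br es a \<in> S"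
  shows "foldr br es v \<in> S"
  using assms(1) by (rule span_induct)
    (use assms(2,3) in \<open>auto simp: foldr_br_linear subspace_def\<close>)

text \<open>Exchanging \<open>e\<close> with a list entry \<open>n\<close> costs a term
  \<open>br (br e n) x\<close>, which lies in \<open>U\<close>. \<open>M\<close> is a mere set, so
  that a union of weight components can serve.\<close>

lemma foldr_br_swap:
  assumes U: "subspace U" "\<And>e w. \<lbrakk>e \<in> A; w \<in> U\<rbrakk> \<Longrightarrow> br e w \<in> U"
    and M: "\<And>e w. \<lbrakk>e \<in> A; w \<in> M\<rbrakk> \<Longrightarrow> br e w \<in> M"
    and comm: "\<And>e f w. \<lbrakk>e \<in> A; f \<in> A; w \<in> M\<rbrakk> \<Longrightarrow> br (br e f) w \<in> U"
    and "e \<in> A" "set ns \<subseteq> A" "w \<in> M"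
  shows "br e (foldr br ns w) - foldr br ns (br e w) \<in> U"
  using assms(6)
proof (induction ns)
  case Nil
  then show ?case using U(1) by (simp add: subspace_0)
next
  case (Cons n ns)
  have inM: "foldr br ms w \<in> M" if "set ms \<subseteq> A" for ms
    using that by (induction ms) (auto intro: M \<open>w \<in> M\<close>)
  have "br e (br n (foldr br ns w)) - br n (foldr br ns (br e w)) =
      br (br e n) (foldr br ns w) + br n (br e (foldr br ns w) - foldr br ns (br e w))"
    by (subst br_jacobi) (simp add: br_diff_right)
  also have "\<dots> \<in> U"
    using Cons \<open>e \<in> A\<close> by (intro subspace_add[OF U(1)] comm U(2) inM) auto
  finally show ?case by simp
qed

text \<open>Repeated swapping brings the operators with \<open>P\<close> to the inner end, where
  they act first. Weights travel in the first components, so that \<open>P\<close> can test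
  them.\<close>

lemma foldr_br_partition:
  assumes U: "subspace U" "\<And>e w. \<lbrakk>e \<in> A; w \<in> U\<rbrakk> \<Longrightarrow> br e w \<in> U"
    and M: "\<And>e w. \<lbrakk>e \<in> A; w \<in> M\<rbrakk> \<Longrightarrow> br e w \<in> M"
    and comm: "\<And>e f w. \<lbrakk>e \<in> A; f \<in> A; w \<in> M\<rbrakk> \<Longrightarrow> br (br e f) w \<in> U"
    and "snd ` set ps \<subseteq> A" "w \<in> M"
  shows "foldr br (map snd ps) w -
    foldr br (map snd (filter (\<lambda>p. \<not> P p) ps)) (foldr br (map snd (filter P ps)) w) \<in> U"
  using assms(5)
proof (induction ps)
  case Nil
  then show ?case using U(1) by (simp add: subspace_0)
next
  case (Cons p ps)
  let ?n = "map snd (filter (\<lambda>p. \<not> P p) ps)"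
  let ?x = "foldr br (map snd (filter P ps)) w"
  have inM: "foldr br ms w \<in> M" if "set ms \<subseteq> A" for ms
    using that by (induction ms) (auto intro: M \<open>w \<in> M\<close>)
  have "br (snd p) (foldr br (map snd ps) w - foldr br ?n ?x) \<in> U"
    using Cons by (intro U(2)) auto
  then have *: "br (snd p) (foldr br (map snd ps) w) - br (snd p) (foldr br ?n ?x) \<in> U"
    by (simp add: br_diff_right)
  have "br (snd p) (foldr br ?n ?x) - foldr br ?n (br (snd p) ?x) \<in> U"
    using Cons.prems by (intro foldr_br_swap[OF U M comm] inM) auto
  from subspace_add[OF U(1) * this] show ?case
    using * by auto
qed

text \<open>Operators of positive weight move a vector through strictly increasing weights,
  all of which must stay in the support.\<close>

lemma length_le_card_above:
  fixes \<phi> :: "'w::ab_group_add \<Rightarrow> 'o::linordered_ab_group_add"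
  assumes \<phi>: "\<And>a b. \<phi> (a + b) = \<phi> a + \<phi> b" and Y: "finite Y" "\<And>a. a \<notin> Y \<Longrightarrow> V a = {0}"
    and EV: "\<And>a b e v. \<lbrakk>e \<in> E a; v \<in> V b\<rbrakk> \<Longrightarrow> br e v \<in> V (a + b)"
    and "\<And>p. p \<in> set ps \<Longrightarrow> snd p \<in> E (fst p) \<and> 0 < \<phi> (fst p)"
    and "v \<in> V c" "foldr br (map snd ps) v \<noteq> 0"
  shows "length ps \<le> card {y \<in> Y. \<phi> c < \<phi> y}"
  using assms(5-)
\<comment> \<open>\<open>foldr\<close> applies the last entry first, so shortening the list at its
  end is what moves the weight of the vector.\<close>
proof (induction ps arbitrary: v c rule: rev_induct)
  case (snoc p ps)
  let ?c = "fst p + c"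
  have v: "br (snd p) v \<in> V ?c" using snoc.prems(1,2) EV by auto
  have "br (snd p) v \<noteq> 0" using snoc.prems(3) by auto
  with v Y(2) have "?c \<in> Y" by fastforce
  have "length ps \<le> card {y \<in> Y. \<phi> ?c < \<phi> y}"
    using snoc.prems v by (intro snoc.IH[of "br (snd p) v"]) auto
  then have *: "Suc (length ps) \<le> card (insert ?c {y \<in> Y. \<phi> ?c < \<phi> y})"
    using Y(1) by simp
  have "\<phi> c < \<phi> ?c"
    using snoc.prems(1)[of p] by (simp add: \<phi>)
  then have "card (insert ?c {y \<in> Y. \<phi> ?c < \<phi> y}) \<le> card {y \<in> Y. \<phi> c < \<phi> y}"
    using \<open>?c \<in> Y\<close> Y(1) by (intro card_mono) auto
  with * show ?case by simp
qed simp

text \<open>Operators commuting modulo \<open>U\<close> may be reordered so that either all those of positive or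
  all those of negative weight act first; these two chains of weights meet only in \<open>c\<close>.\<close>

lemma foldr_br_mem:
  fixes \<phi> :: "'w::ab_group_add \<Rightarrow> 'o::linordered_ab_group_add"
  assumes \<phi>: "\<And>a b. \<phi> (a + b) = \<phi> a + \<phi> b" "\<And>a. a \<in> Y \<Longrightarrow> \<phi> a \<noteq> 0"
    and Y: "finite Y" "\<And>a. a \<notin> Y \<Longrightarrow> V a = {0}" "\<And>a. a \<notin> Y \<Longrightarrow> E a = {0}"
    and EV: "\<And>a b e v. \<lbrakk>e \<in> E a; v \<in> V b\<rbrakk> \<Longrightarrow> br e v \<in> V (a + b)"
    and U: "subspace U" "\<And>a e w. \<lbrakk>e \<in> E a; w \<in> U\<rbrakk> \<Longrightarrow> br e w \<in> U"
    and comm: "\<And>a b c e f w. \<lbrakk>e \<in> E a; f \<in> E b; w \<in> V c\<rbrakk> \<Longrightarrow> br (br e f) w \<in> U"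
    and ps: "\<And>p. p \<in> set ps \<Longrightarrow> snd p \<in> E (fst p)" "length ps = card Y"
    and v: "v \<in> V c"
  shows "foldr br (map snd ps) v \<in> U"
proof (cases "v = 0 \<or> 0 \<in> snd ` set ps")
  case True
  then show ?thesis
    using foldr_br_zero_mem[of "map snd ps" v] subspace_0[OF U(1)] unfolding set_map by fastforce
next
  case False
  then have "c \<in> Y" using v Y(2) by fastforce
  have psY: "fst p \<in> Y" if "p \<in> set ps" for p
    using that ps(1) Y(3) False by (metis image_eqI singletonD)
  define pos neg where "pos = filter (\<lambda>p. 0 < \<phi> (fst p)) ps" and "neg = filter (\<lambda>p. \<not> 0 < \<phi> (fst p)) ps"
  have part: "foldr br (map snd ps) v -
      foldr br (map snd (filter (\<lambda>p. \<not> P p) ps)) (foldr br (map snd (filter P ps)) v) \<in> U" for P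
    by (rule foldr_br_partition[where A = "\<Union>a. E a" and M = "\<Union>a. V a"])
      (use U EV comm ps(1) v in \<open>auto, blast+\<close>)
  have "foldr br (map snd pos) v = 0 \<or> foldr br (map snd neg) v = 0"
  proof (rule ccontr)
    assume "\<not> ?thesis"
    then have ne: "foldr br (map snd pos) v \<noteq> 0" "foldr br (map snd neg) v \<noteq> 0" by auto
    have "length pos \<le> card {y \<in> Y. \<phi> c < \<phi> y}"
      by (rule length_le_card_above[OF \<phi>(1) Y(1,2) EV _ v ne(1)]) (use ps(1) in \<open>auto simp: pos_def\<close>)
    moreover have "length neg \<le> card {y \<in> Y. - \<phi> c < - \<phi> y}"
    proof (rule length_le_card_above[where \<phi> = "\<lambda>x. - \<phi> x", OF _ Y(1,2) EV _ v ne(2)])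
      show "snd p \<in> E (fst p) \<and> 0 < - \<phi> (fst p)" if "p \<in> set neg" for p
        using that ps(1) \<phi>(2)[OF psY[of p]] by (auto simp: neg_def)
    qed (auto simp: \<phi>(1))
    moreover have "length pos + length neg = card Y"
      using sum_length_filter_compl[of "\<lambda>p. 0 < \<phi> (fst p)" ps] ps(2) by (simp add: pos_def neg_def)
    \<comment> \<open>\<open>c\<close> is in the support but in neither set; this makes
      \<open>card Y\<close> operators too many.\<close>
    moreover have "card {y \<in> Y. \<phi> c < \<phi> y} + card {y \<in> Y. - \<phi> c < - \<phi> y} < card Y"
    proof -
      have "card {y \<in> Y. \<phi> c < \<phi> y} + card {y \<in> Y. - \<phi> c < - \<phi> y}
          = card ({y \<in> Y. \<phi> c < \<phi> y} \<union> {y \<in> Y. - \<phi> c < - \<phi> y})"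
        using Y(1) by (subst card_Un_disjoint) auto
      also have "\<dots> < card Y"
        using Y(1) \<open>c \<in> Y\<close> by (intro psubset_card_mono) auto
      finally show ?thesis .
    qed
    ultimately show False by simp
  qed
  then show ?thesis
    using part[of "\<lambda>p. 0 < \<phi> (fst p)"] part[of "\<lambda>p. \<not> 0 < \<phi> (fst p)"]
    by (auto simp: pos_def neg_def)
qed

text \<open>Filter \<open>F\<close> by layers \<open>V i\<close>, obtained by multiplying
  \<open>i\<close> times by \<open>derived E\<close>. A block of \<open>card Y\<close> operators
  from \<open>E\<close> descends one layer, and by induction, applied to \<open>derived E\<close>,
  layer \<open>card Y ^ m\<close> is zero. So \<open>card Y * card Y ^ m\<close> operators suffice.
  For \<open>m = 0\<close> the single operator is itself 0.\<close>

lemma foldr_br_eq_0: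
  fixes \<phi> :: "'w::ab_group_add \<Rightarrow> 'o::linordered_ab_group_add"
  assumes \<phi>: "\<And>a b. \<phi> (a + b) = \<phi> a + \<phi> b" "\<And>a. a \<in> Y \<Longrightarrow> \<phi> a \<noteq> 0"
    and Y: "finite Y" "\<And>a. a \<notin> Y \<Longrightarrow> F a = {0}" and F: "graded_subalgebra F"
    and "graded_subalgebra E" "\<And>a. E a \<subseteq> F a" "\<And>a. (derived ^^ m) E a = {0}"
    and "\<And>p. p \<in> set ps \<Longrightarrow> snd p \<in> E (fst p)" "length ps = card Y ^ m" "v \<in> F c"
  shows "foldr br (map snd ps) v = 0"
  using assms(6-)
proof (induction m arbitrary: E ps v c)
  case 0
  then have "0 \<in> set (map snd ps)"
    by (cases ps) auto
  then show ?case
    by (rule foldr_br_zero_mem)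
next
  case (Suc m)
  note E = Suc.prems(1) and EF = Suc.prems(2)
  define V where "V i = (graded_product (derived E) ^^ i) F" for i
  have V_0: "V 0 = F" and V_Suc: "V (Suc i) = graded_product (derived E) (V i)" for i
    by (simp_all add: V_def)
  have E0: "E a = {0}" if "a \<notin> Y" for a
    using Y(2)[OF that] EF[of a] subspace_0[OF graded_subalgebraD(1)[OF E]] by blast
  have subV: "subspace (V i a)" for i a
    by (cases i) (auto simp: V_0 V_Suc graded_product_def graded_subalgebraD[OF F])
  \<comment> \<open>\<open>derived E\<close> is an ideal of \<open>E\<close>, so by Jacobi
    \<open>e\<close> may act on either factor of a generator of the layer.\<close>
  have EV: "br e w \<in> V i (a + b)" if "e \<in> E a" "w \<in> V i b" for e w a b i
    using that
  proof (induction i arbitrary: e w a b)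
    case 0
    then show ?case
      using subsetD[OF EF] graded_subalgebraD(2)[OF F] by (simp add: V_0)
  next
    case (Suc i)
    have "br e (br f x) \<in> V (Suc i) (a + (b1 + b2))"
      if fx: "f \<in> derived E b1" "x \<in> V i b2" for f x b1 b2
    proof -
      have "br (br e f) x \<in> V (Suc i) ((a + b1) + b2)"
        using fx Suc.prems(1) derived_subset[OF E] unfolding V_Suc by (blast intro: graded_productI)
      moreover have "br f (br e x) \<in> V (Suc i) (b1 + (a + b2))"
        using fx Suc.prems(1) Suc.IH unfolding V_Suc by (blast intro: graded_productI)
      ultimately show ?thesis
        by (subst br_jacobi) (simp add: ac_simps subspace_add[OF subV])
    qed
    with Suc.prems(2) show ?case
      unfolding V_Suc graded_product_def[of _ _ b]
      by (elim br_span_right) (auto simp: V_Suc[symmetric] subV)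
  qed
  have dE: "u \<in> derived E a \<Longrightarrow> u \<in> E a" for u a
    using derived_subset[OF E] by blast
  have VF: "V i a \<subseteq> F a" for i a
  proof (induction i arbitrary: a)
    case (Suc i)
    have "br u v \<in> F a" if "u \<in> derived E b" "v \<in> V i c" "b + c = a" for u v b c
      using graded_subalgebraD(2)[OF F subsetD[OF EF dE[OF that(1)]] subsetD[OF Suc that(2)]] that(3)
      by simp
    then show ?case
      unfolding V_Suc using graded_subalgebraD(1)[OF F] by (intro graded_product_least)
  qed (simp add: V_0)
  have V0: "V i a = {0}" if "a \<notin> Y" for a i
    using Y(2)[OF that] VF[of i a] subspace_0[OF subV] by blast
  \<comment> \<open>A vector of layer \<open>i\<close> already carries \<open>i\<close> operators
    from \<open>derived E\<close>; with \<open>qs\<close> they add up to the number required by the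
    induction hypothesis.\<close>
  have top: "foldr br (map snd qs) w = 0"
    if "w \<in> V i b" "length qs + i = card Y ^ m" "\<And>p. p \<in> set qs \<Longrightarrow> snd p \<in> derived E (fst p)"
    for i qs w b
    using that
  proof (induction i arbitrary: qs w b)
    case 0
    show ?case
    proof (rule Suc.IH)
      show "graded_subalgebra (derived E)" by (rule graded_subalgebra_derived[OF E])
      show "(derived ^^ m) (derived E) a = {0}" for a
        using Suc.prems(3)[of a] unfolding funpow_Suc_right o_apply .
      show "derived E a \<subseteq> F a" for a using dE EF by blast
      show "w \<in> F b" using 0 by (simp add: V_0)
    qed (use 0 in auto)
  next
    case (Suc i)
    have "foldr br (map snd qs) (br f x) = 0" if "f \<in> derived E b1" "x \<in> V i b2" for f x b1 b2
    proof -
      have "foldr br (map snd (qs @ [(b1, f)])) x = 0"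
        by (rule Suc.IH[OF that(2)]) (use Suc.prems(2,3) that(1) in auto)
      then show ?thesis by simp
    qed
    with Suc.prems(1) have "foldr br (map snd qs) w \<in> {0}"
      unfolding V_Suc graded_product_def by (elim foldr_br_span) auto
    then show ?case by simp
  qed
  define U where "U i = span (\<Union>a. V i a)" for i
  have VU: "w \<in> V i a \<Longrightarrow> w \<in> U i" for w i a
    unfolding U_def by (rule span_base) blast
  \<comment> \<open>A bracket of two elements of \<open>E\<close> lies in \<open>derived E\<close>
    and sends layer \<open>i\<close> into the next one, so modulo \<open>U (Suc i)\<close> the
    operators commute.\<close>
  have step: "foldr br (map snd qs) w \<in> U (Suc i)"
    if w: "w \<in> U i" and qs: "\<And>p. p \<in> set qs \<Longrightarrow> snd p \<in> E (fst p)" "length qs = card Y" for i w qs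
  proof -
    have "foldr br (map snd qs) x \<in> U (Suc i)" if "x \<in> V i b" for x b
    proof (rule foldr_br_mem[OF \<phi> Y(1) V0 E0 EV _ _ _ qs that])
      show "br e w \<in> U (Suc i)" if "e \<in> E a" "w \<in> U (Suc i)" for a e w
      proof (rule br_span_right[OF that(2)[unfolded U_def]])
        show "br e x \<in> U (Suc i)" if "x \<in> (\<Union>a. V (Suc i) a)" for x
          using that EV[OF \<open>e \<in> E a\<close>] VU by blast
      qed (simp add: U_def)
      show "br (br e f) x \<in> U (Suc i)" if "e \<in> E a" "f \<in> E b" "x \<in> V i c" for a b c e f x
      proof -
        have "br e f \<in> derived E (a + b)" using that by (blast intro: graded_productI)
        then show ?thesis
          using that(3) graded_productI[where E = "derived E" and F = "V i" and b = "a + b" and c = c]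
          by (intro VU[of _ _ "a + b + c"]) (simp add: V_Suc)
      qed
    qed (auto simp: U_def)
    then show ?thesis
      using w[unfolded U_def] by (elim foldr_br_span) (auto simp: U_def)
  qed
  have "foldr br (map snd qs) v \<in> U i"
    if "\<And>p. p \<in> set qs \<Longrightarrow> snd p \<in> E (fst p)" "length qs = card Y * i" for i qs
    using that
  proof (induction i arbitrary: qs)
    case 0
    then show ?case using Suc.prems(6) VU[of v 0 c] by (simp add: V_0)
  next
    case (Suc i)
    let ?k = "card Y"
    have "foldr br (map snd (drop ?k qs)) v \<in> U i"
      using Suc.prems by (intro Suc.IH) (auto dest: in_set_dropD)
    then have "foldr br (map snd (take ?k qs)) (foldr br (map snd (drop ?k qs)) v) \<in> U (Suc i)"
      using Suc.prems by (intro step) (auto dest: in_set_takeD)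
    then show ?case
      by (metis append_take_drop_id comp_apply foldr_append map_append)
  qed
  from this[of ps "card Y ^ m"] have "foldr br (map snd ps) v \<in> U (card Y ^ m)"
    using Suc.prems by simp
  moreover have "V (card Y ^ m) a \<subseteq> {0}" for a
    using top[of _ "card Y ^ m" a "[]"] by auto
  then have "U (card Y ^ m) \<subseteq> {0}"
    unfolding U_def by (intro span_minimal) auto
  ultimately show ?case by blast
qed

end

section \<open>Representations of nilpotent Lie algebras\<close>

context finite_dimensional_vector_space
begin

section \<open>Polynomials in a linear operator, and its eigenvalues\<close>

definition papply :: "('b \<Rightarrow> 'b) \<Rightarrow> 'a poly \<Rightarrow> 'b \<Rightarrow> 'b" where
  "papply T p v = (\<Sum>i\<le>degree p. scale (coeff p i) ((T ^^ i) v))"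

lemma linear_image_subspace:
  assumes "Vector_Spaces.linear scale scale T" "subspace S"
  shows "subspace (T ` S)"
proof -
  interpret T: Vector_Spaces.linear scale scale T by fact
  show ?thesis by (rule T.subspace_image[OF assms(2)])
qed

lemma linear_kernel_subspace:
  assumes "Vector_Spaces.linear scale scale T"
  shows "subspace {w. T w = 0}"
proof -
  interpret T: Vector_Spaces.linear scale scale T by fact
  show ?thesis by (rule T.subspace_kernel)
qed

lemma papply_bound:
    assumes "degree p \<le> n"
  shows "papply T p v = (\<Sum>i\<le>n. scale (coeff p i) ((T ^^ i) v))"
  unfolding papply_def
  by (rule sum.mono_neutral_left) (use assms in \<open>auto simp: coeff_eq_0 not_le\<close>)

lemma papply_0 [simp]: "papply T 0 v = 0"
  by (simp add: papply_def)

lemma papply_add: "papply T (p + q) v = papply T p v + papply T q v"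
  using papply_bound[of p "max (degree p) (degree q)" T v]
    papply_bound[of q "max (degree p) (degree q)" T v]
    papply_bound[OF degree_add_le_max[of p q], of T v]
  by (simp add: scale_left_distrib sum.distrib)

lemma papply_smult: "papply T (smult a p) v = scale a (papply T p v)"
  using papply_bound[OF degree_smult_le[of a p], of T v]
  by (simp add: papply_def scale_sum_right)

lemma papply_pCons:
  assumes "Vector_Spaces.linear scale scale T"
  shows "papply T (pCons a p) v = scale a v + T (papply T p v)"
proof -
  interpret T: Vector_Spaces.linear scale scale T by fact
  have "papply T (pCons a p) v = (\<Sum>i\<le>Suc (degree p). scale (coeff (pCons a p) i) ((T ^^ i) v))"
    by (rule papply_bound) (simp add: degree_pCons_le)
  also have "\<dots> = scale a v + (\<Sum>i\<le>degree p. scale (coeff p i) (T ((T ^^ i) v)))"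
    by (subst sum.atMost_Suc_shift) simp
  finally show ?thesis by (simp add: papply_def T.sum T.scale)
qed

lemma papply_mult:
  assumes T: "Vector_Spaces.linear scale scale T"
  shows "papply T (p * q) v = papply T p (papply T q v)"
proof (induction p)
  case (pCons a p)
  then show ?case
    by (simp add: papply_add papply_smult papply_pCons[OF T])
qed simp

lemma papply_linear:
  assumes "Vector_Spaces.linear scale scale T"
  shows "papply T p (u + v) = papply T p u + papply T p v"
    and "papply T p (scale c v) = scale c (papply T p v)"
proof -
  interpret T: Vector_Spaces.linear scale scale T by fact
  show "papply T p (u + v) = papply T p u + papply T p v"
    by (induction p) (simp_all add: papply_pCons[OF assms] T.add scale_right_distrib)
  show "papply T p (scale c v) = scale c (papply T p v)"
    by (induction p) (simp_all add: papply_pCons[OF assms] T.scale scale_right_distrib mult.commute)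
qed

lemma papply_mem:
  assumes "Vector_Spaces.linear scale scale T" "subspace W" "\<And>w. w \<in> W \<Longrightarrow> T w \<in> W" "v \<in> W"
  shows "papply T p v \<in> W"
  by (induction p) (simp_all add: papply_pCons[OF assms(1)] assms subspace_0 subspace_add subspace_scale)

lemma papply_eigenvector:
  assumes "Vector_Spaces.linear scale scale T" "T v = scale a v"
  shows "papply T p v = scale (poly p a) v"
proof -
  interpret T: Vector_Spaces.linear scale scale T by fact
  show ?thesis
    by (induction p) (simp_all add: papply_pCons[OF assms(1)] T.scale assms(2) scale_left_distrib mult.commute)
qed

lemma linear_funpow:
  assumes "Vector_Spaces.linear scale scale T"
  shows "Vector_Spaces.linear scale scale (T ^^ k)"
proof -
  interpret T: Vector_Spaces.linear scale scale T by fact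
  have "(T ^^ k) (u + v) = (T ^^ k) u + (T ^^ k) v"
    "(T ^^ k) (scale c v) = scale c ((T ^^ k) v)" for u v c
    by (induction k) (simp_all add: T.add T.scale)
  then show ?thesis
    using vector_space_axioms by (simp add: Vector_Spaces.linear_iff)
qed

lemma dim_less:
  assumes "subspace U" "subspace W" "U \<subset> W"
  shows "dim U < dim W"
  using assms by (metis dim_psubset span_eq_iff)

lemma descending_subspaces_stable:
  assumes "\<And>n::nat. subspace (f n)" "\<And>n. f (Suc n) \<subseteq> f n"
  shows "\<exists>N. \<forall>m\<ge>N. f m = f N"
proof -
  obtain N where N: "\<And>m. dim (f N) \<le> dim (f m)"
    using ex_has_least_nat[of "\<lambda>_. True" _ "\<lambda>n. dim (f n)"] by auto
  have "f m = f N" if "N \<le> m" for m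
    using lift_Suc_antimono_le[of f, OF assms(2) that] N[of m] assms(1) by (intro subspace_dim_equal)
  then show ?thesis by blast
qed

lemma ascending_subspaces_stable:
  assumes "\<And>n::nat. subspace (f n)" "\<And>n. f n \<subseteq> f (Suc n)"
  shows "\<exists>N. \<forall>m\<ge>N. f m = f N"
proof -
  obtain N where N: "\<And>m. dim (f m) \<le> dim (f N)"
    using ex_has_greatest_nat[of "\<lambda>_. True" _ "\<lambda>n. dim (f n)" "Suc dimension"] dim_subset_UNIV
    by (auto simp: less_Suc_eq_le)
  have "f m = f N" if "N \<le> m" for m
    using lift_Suc_mono_le[of f, OF assms(2) that] N[of m] assms(1)
    by (intro subspace_dim_equal[symmetric])
  then show ?thesis by blast
qed

text \<open>One more iterate of \<open>v\<close> than the dimension forces a linear dependency,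
  whose coefficients form the polynomial.\<close>

lemma annihilating_poly:
  assumes T: "Vector_Spaces.linear scale scale T"
  shows "\<exists>p. p \<noteq> 0 \<and> papply T p v = 0"
proof (rule ccontr)
  assume "\<not> ?thesis"
  then have no: "papply T p v = 0 \<Longrightarrow> p = 0" for p by blast
  have mono: "papply T (monom a n) v = scale a ((T ^^ n) v)" for a n
    using papply_bound[OF degree_monom_le[of a n], of T v] by (simp add: if_distrib[of "\<lambda>c. scale c _"] cong: if_cong)
  let ?f = "\<lambda>i. (T ^^ i) v"
  \<comment> \<open>Independence concerns the set of iterates, so equal iterates must be excluded
    first; they would yield the annihilating polynomial X^i - X^j.\<close>
  have inj: "inj ?f"
  proof (rule injI)
    fix i j
    assume "?f i = ?f j"
    then have "papply T (monom 1 i + smult (- 1) (monom 1 j)) v = 0"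
      by (simp only: papply_add papply_smult mono) simp
    then have "monom 1 i + smult (- 1) (monom (1::'a) j) = 0"
      by (rule no)
    then have "coeff (monom 1 i + smult (- 1) (monom (1::'a) j)) i = 0"
      by (simp only: coeff_0)
    then show "i = j" by (auto split: if_splits)
  qed
  have "independent (?f ` {..dimension})"
  proof (rule independent_if_scalars_zero)
    fix g x
    assume "(\<Sum>x\<in>?f ` {..dimension}. scale (g x) x) = 0" and x: "x \<in> ?f ` {..dimension}"
    then have 0: "(\<Sum>i\<le>dimension. scale (g (?f i)) (?f i)) = 0"
      by (simp add: sum.reindex inj_on_subset[OF inj])
    define p where "p = (\<Sum>i\<le>dimension. monom (g (?f i)) i)"
    have "papply T (\<Sum>i\<le>n. monom (g (?f i)) i) v = (\<Sum>i\<le>n. scale (g (?f i)) (?f i))" for n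
      by (induction n) (simp_all add: papply_add mono)
    then have "papply T p v = (\<Sum>i\<le>dimension. scale (g (?f i)) (?f i))"
      unfolding p_def .
    with 0 no have "p = 0" by simp
    moreover have "coeff p i = g (?f i)" if "i \<le> dimension" for i
      using that by (simp add: p_def coeff_sum)
    ultimately show "g x = 0" using x by auto
  qed simp
  then have "card (?f ` {..dimension}) \<le> dim (UNIV :: 'b set)"
    by (intro independent_card_le_dim) auto
  then show False
    by (simp add: card_image inj_on_subset[OF inj] dimension_def)
qed

lemma minimal_poly:
  assumes "Vector_Spaces.linear scale scale T"
  obtains p where "p \<noteq> 0" "papply T p v = 0" "\<And>q. \<lbrakk>q \<noteq> 0; papply T q v = 0\<rbrakk> \<Longrightarrow> degree p \<le> degree q"
  using annihilating_poly[OF assms, of v]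
    ex_has_least_nat[of "\<lambda>p. p \<noteq> 0 \<and> papply T p v = 0" _ degree] by blast

text \<open>The product of annihilating polynomials of the basis vectors kills the whole space, and
  every eigenvalue is a root of it.\<close>

lemma finite_eigenvalues:
  assumes T: "Vector_Spaces.linear scale scale T"
  shows "finite {a. \<exists>v. v \<noteq> 0 \<and> T v = scale a v}"
proof -
  obtain p where p: "\<And>b. p b \<noteq> 0" "\<And>b. papply T (p b) b = 0"
    using annihilating_poly[OF T] by metis
  define q where "q = prod p Basis"
  have q: "q \<noteq> 0" unfolding q_def using p(1) by (simp add: finite_Basis)
  have qb: "papply T q b = 0" if b: "b \<in> Basis" for b
  proof -
    have "q = prod p (Basis - {b}) * p b"
      unfolding q_def by (metis b finite_Basis mult.commute prod.remove)
    then show ?thesis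
      using p(2)[of b] papply_linear(2)[OF T, of _ 0 b] by (simp add: papply_mult[OF T])
  qed
  have "papply T q v = 0" if "v \<in> span Basis" for v
    using that by (induction rule: span_induct_alt)
      (use qb papply_linear[OF T, of q] papply_linear(2)[OF T, of q 0 0] in auto)
  then have q0: "papply T q v = 0" for v
    by (simp add: span_Basis)
  have "{a. \<exists>v. v \<noteq> 0 \<and> T v = scale a v} \<subseteq> {a. poly q a = 0}"
    using q0 papply_eigenvector[OF T, of _ _ q] by auto
  then show ?thesis
    using poly_roots_finite[OF q] finite_subset by blast
qed

text \<open>If p = (X - a) q is the minimal polynomial of a nonzero \<open>v\<close> in
  \<open>W\<close>, then q(T) v is nonzero, is killed by T - a, and stays in \<open>W\<close> by
  invariance.\<close>

lemma ex_eigenvector: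
  fixes T :: "'b \<Rightarrow> 'b" and W :: "'b set"
  assumes alg_closed: "\<And>p :: 'a poly. 0 < degree p \<Longrightarrow> \<exists>a. poly p a = 0"
    and T: "Vector_Spaces.linear scale scale T" and W: "subspace W" "\<And>w. w \<in> W \<Longrightarrow> T w \<in> W" "W \<noteq> {0}"
  obtains v a where "v \<in> W" "v \<noteq> 0" "T v = scale a v"
proof -
  obtain v where v: "v \<in> W" "v \<noteq> 0" using W subspace_0[OF W(1)] by blast
  obtain p where p: "p \<noteq> 0" "papply T p v = 0" "\<And>q. \<lbrakk>q \<noteq> 0; papply T q v = 0\<rbrakk> \<Longrightarrow> degree p \<le> degree q"
    using minimal_poly[OF T, of v] by blast
  have "degree p \<noteq> 0"
  proof
    assume "degree p = 0"
    then obtain c where "p = [:c:]" by (metis degree_eq_zeroE)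
    then show False using p(1,2) v(2) by (simp add: papply_def)
  qed
  then obtain a where "poly p a = 0" using alg_closed by blast
  then obtain q where q: "p = [:- a, 1:] * q" by (metis dvdE poly_eq_0_iff_dvd)
  then have "q \<noteq> 0" using p(1) by auto
  then have "degree q < degree p" unfolding q by (subst degree_mult_eq) auto
  then have "papply T q v \<noteq> 0" using p(3)[OF \<open>q \<noteq> 0\<close>] by auto
  moreover have "papply T q v \<in> W" using papply_mem[OF T W(1,2) v(1)] .
  moreover have "T (papply T q v) = scale a (papply T q v)"
  proof -
    interpret T: Vector_Spaces.linear scale scale T by fact
    show ?thesis
      using p(2) unfolding q papply_mult[OF T] by (simp add: papply_pCons[OF T])
  qed
  ultimately show ?thesis using that by blast
qed

end

text \<open>Nilpotency of the acting algebra is recorded by the chain \<open>C\<close>, later its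
  lower central series. It gives all \<open>ad x\<close> a common nilpotency index \<open>cl\<close>
  and allows induction from \<open>C cl\<close> down to \<open>C 0\<close>.\<close>

locale nilpotent_rep = finite_dimensional_vector_space scale Basis
  for scale :: "'k::{alg_closed_field, field_char_0} \<Rightarrow> 'v::ab_group_add \<Rightarrow> 'v" and Basis :: "'v set" +
  fixes L :: "'x::ab_group_add \<Rightarrow> 'v \<Rightarrow> 'v" and ad :: "'x \<Rightarrow> 'x \<Rightarrow> 'x" and C :: "nat \<Rightarrow> 'x set" and cl :: nat
  assumes L_linear: "Vector_Spaces.linear scale scale (L x)"
    and L_add: "L (x + y) v = L x v + L y v"
    and L_ad: "L (ad x y) v = L x (L y v) - L y (L x v)"
    and C_0: "C 0 = UNIV" and C_Suc: "y \<in> C i \<Longrightarrow> ad x y \<in> C (Suc i)" and C_cl: "C cl = {0}"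
begin

lemma L_simps [simp]:
  "L x (u + v) = L x u + L x v" "L x (u - v) = L x u - L x v" "L x 0 = 0" "L 0 v = 0"
  "L x (scale c v) = scale c (L x v)"
proof -
  interpret L: Vector_Spaces.linear scale scale "L x" by (rule L_linear)
  show "L x (u + v) = L x u + L x v" "L x (u - v) = L x u - L x v" "L x 0 = 0"
    "L x (scale c v) = scale c (L x v)"
    by (rule L.add L.diff L.zero L.scale)+
  show "L 0 v = 0" using L_add[of 0 0 v] by simp
qed

lemma ad_nilpotent: "(ad x ^^ cl) y = 0"
proof -
  have "(ad x ^^ i) y \<in> C i" for i
    by (induction i) (auto simp: C_0 intro: C_Suc)
  then show ?thesis using C_cl by blast
qed

section \<open>Common eigenvectors of a nilpotent Lie algebra\<close>

definition submodule :: "'v set \<Rightarrow> bool" where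
  "submodule W \<longleftrightarrow> subspace W \<and> (\<forall>x. \<forall>w\<in>W. L x w \<in> W)"

lemma submoduleD: "submodule W \<Longrightarrow> subspace W" "submodule W \<Longrightarrow> w \<in> W \<Longrightarrow> L x w \<in> W"
  by (auto simp: submodule_def)

lemma L_eigenvector:
  assumes "submodule W" "W \<noteq> {0}"
  obtains v a where "v \<in> W" "v \<noteq> 0" "L x v = scale a v"
  using ex_eigenvector[OF alg_closed_imp_poly_has_root L_linear submoduleD(1)[OF assms(1)] submoduleD(2)[OF assms(1)] assms(2)]
  by blast

lemma irreducible_submodule:
  assumes "submodule W" "W \<noteq> {0}"
  obtains M where "submodule M" "M \<noteq> {0}" "M \<subseteq> W"
    "\<And>U. \<lbrakk>submodule U; U \<noteq> {0}; U \<subseteq> M\<rbrakk> \<Longrightarrow> U = M"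
proof -
  obtain M where M: "submodule M" "M \<noteq> {0}" "M \<subseteq> W"
    and min: "\<And>U. \<lbrakk>submodule U; U \<noteq> {0}; U \<subseteq> W\<rbrakk> \<Longrightarrow> dim M \<le> dim U"
    using ex_has_least_nat[of "\<lambda>U. submodule U \<and> U \<noteq> {0} \<and> U \<subseteq> W" W dim] assms by blast
  have "U = M" if "submodule U" "U \<noteq> {0}" "U \<subseteq> M" for U
    using min[of U] that M by (intro subspace_dim_equal) (auto simp: submodule_def)
  then show ?thesis using that M by blast
qed

text \<open>An eigenspace of \<open>L z\<close> in \<open>M\<close> is a submodule because
  \<open>L z\<close> commutes with the action; irreducibility makes it all of
  \<open>M\<close>.\<close>

lemma schur:
  assumes M: "submodule M" "M \<noteq> {0}" "\<And>U. \<lbrakk>submodule U; U \<noteq> {0}; U \<subseteq> M\<rbrakk> \<Longrightarrow> U = M"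
    and comm: "\<And>x w. w \<in> M \<Longrightarrow> L x (L z w) = L z (L x w)"
  obtains a where "\<And>w. w \<in> M \<Longrightarrow> L z w = scale a w"
proof -
  obtain v a where v: "v \<in> M" "v \<noteq> 0" "L z v = scale a v"
    using L_eigenvector[OF M(1,2)] by blast
  let ?U = "{w \<in> M. L z w = scale a w}"
  have "submodule ?U"
    using submoduleD[OF M(1)] comm
    by (auto simp: submodule_def subspace_def scale_right_distrib mult.commute simp flip: comm)
  then have "?U = M" using v by (intro M(3)) auto
  then show ?thesis using that by blast
qed

text \<open>If \<open>L e v = a v\<close>, then \<open>L e - a\<close> sends \<open>p(L z) v\<close> to \<open>c p'(L z) v\<close>; for \<open>c\<close> nonzero this
  contradicts the minimality of an annihilating polynomial \<open>p\<close>.\<close>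

lemma commutator_not_scalar:
  assumes W: "submodule W" "W \<noteq> {0}"
    and comm: "\<And>w. w \<in> W \<Longrightarrow> L e (L z w) - L z (L e w) = scale c w"
  shows "c = 0"
proof (rule ccontr)
  assume "c \<noteq> 0"
  obtain v a where v: "v \<in> W" "v \<noteq> 0" "L e v = scale a v"
    using L_eigenvector[OF W] by blast
  obtain p where p: "p \<noteq> 0" "papply (L z) p v = 0"
    "\<And>q. \<lbrakk>q \<noteq> 0; papply (L z) q v = 0\<rbrakk> \<Longrightarrow> degree p \<le> degree q"
    using minimal_poly[OF L_linear, of z v] by blast
  have mem: "papply (L z) q v \<in> W" for q
    by (intro papply_mem[OF L_linear submoduleD(1)[OF W(1)] _ v(1)] submoduleD(2)[OF W(1)])
  have deriv: "L e (papply (L z) q v) = scale a (papply (L z) q v) + scale c (papply (L z) (pderiv q) v)" for q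
  proof (induction q)
    case (pCons b q)
    let ?w = "papply (L z) q v"
    have "L e (L z ?w) = L z (L e ?w) + scale c ?w"
      using comm[OF mem[of q]] by (simp add: algebra_simps)
    then show ?case
      using pCons.IH v(3)
      by (simp add: papply_pCons[OF L_linear] pderiv_pCons papply_add scale_right_distrib mult.commute add_ac)
  qed simp
  have "papply (L z) (pderiv p) v = 0"
    using deriv[of p] p(2) \<open>c \<noteq> 0\<close> by simp
  moreover have "degree p \<noteq> 0"
  proof
    assume "degree p = 0"
    then obtain b where "p = [:b:]" by (metis degree_eq_zeroE)
    then show False using p(1,2) v(2) by (simp add: papply_def)
  qed
  ultimately show False
    using p(3)[of "pderiv p"] by (auto simp: pderiv_eq_0_iff degree_pderiv)
qed

text \<open>On an irreducible submodule every \<open>L z\<close> is scalar, by induction along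
  \<open>C\<close> from its zero end: if all \<open>L (ad x z)\<close> are scalars,
  \<open>commutator_not_scalar\<close> makes them zero, and then \<open>schur\<close> applies to
  \<open>z\<close>.\<close>

theorem common_eigenvector:
  assumes "submodule W" "W \<noteq> {0}"
  obtains v \<alpha> where "v \<in> W" "v \<noteq> 0" "\<And>x. L x v = scale (\<alpha> x) v"
proof -
  obtain M where M: "submodule M" "M \<noteq> {0}" "M \<subseteq> W"
    and irr: "\<And>U. \<lbrakk>submodule U; U \<noteq> {0}; U \<subseteq> M\<rbrakk> \<Longrightarrow> U = M"
    using irreducible_submodule[OF assms] by blast
  define scalar where "scalar z \<longleftrightarrow> (\<exists>a. \<forall>w\<in>M. L z w = scale a w)" for z
  have "\<forall>z\<in>C i. scalar z" if "i \<le> cl" for i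
    using that
  proof (induction rule: inc_induct)
    case base
    then show ?case by (auto simp: C_cl scalar_def intro: exI[of _ 0])
  next
    case (step i)
    show ?case
    proof
      fix z
      assume z: "z \<in> C i"
      have comm: "L x (L z w) = L z (L x w)" if "w \<in> M" for x w
      proof -
        obtain a where a: "\<And>w. w \<in> M \<Longrightarrow> L (ad x z) w = scale a w"
          using step.IH C_Suc[OF z] unfolding scalar_def by blast
        then have "a = 0"
          by (intro commutator_not_scalar[OF M(1,2), of x z]) (simp flip: L_ad)
        then show ?thesis using a[OF that] by (simp add: L_ad)
      qed
      obtain a where "\<And>w. w \<in> M \<Longrightarrow> L z w = scale a w"
        by (rule schur[OF M(1,2) irr comm]) blast+
      then show "scalar z"
        unfolding scalar_def by blast
    qed
  qed
  from this[of 0] have "\<forall>z. \<exists>a. \<forall>w\<in>M. L z w = scale a w"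
    unfolding C_0 scalar_def by simp
  then have "\<exists>\<alpha>. \<forall>z. \<forall>w\<in>M. L z w = scale (\<alpha> z) w"
    by (rule choice)
  then obtain \<alpha> where \<alpha>: "\<forall>z. \<forall>w\<in>M. L z w = scale (\<alpha> z) w" ..
  obtain v where v: "v \<in> M" "v \<noteq> 0" using M(2) subspace_0[OF submoduleD(1)[OF M(1)]] by blast
  show ?thesis
    by (rule that[of v \<alpha>]) (use \<alpha> v M(3) in auto)
qed

section \<open>Generalized weight spaces and Fitting decompositions\<close>

definition shifted :: "'x \<Rightarrow> 'k \<Rightarrow> 'v \<Rightarrow> 'v" where
  "shifted x a v = L x v - scale a v"

lemma linear_shifted: "Vector_Spaces.linear scale scale (shifted x a)"
  using vector_space_axioms
  by (simp add: Vector_Spaces.linear_iff shifted_def algebra_simps)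

lemma shifted_simps [simp]:
  "(shifted x a ^^ k) (u + v) = (shifted x a ^^ k) u + (shifted x a ^^ k) v"
  "(shifted x a ^^ k) (u - v) = (shifted x a ^^ k) u - (shifted x a ^^ k) v"
  "(shifted x a ^^ k) 0 = 0"
  "(shifted x a ^^ k) (scale c v) = scale c ((shifted x a ^^ k) v)"
proof -
  interpret T: Vector_Spaces.linear scale scale "shifted x a ^^ k"
    by (intro linear_funpow linear_shifted)
  show "(shifted x a ^^ k) (u + v) = (shifted x a ^^ k) u + (shifted x a ^^ k) v"
    "(shifted x a ^^ k) (u - v) = (shifted x a ^^ k) u - (shifted x a ^^ k) v"
    "(shifted x a ^^ k) 0 = 0"
    "(shifted x a ^^ k) (scale c v) = scale c ((shifted x a ^^ k) v)"
    by (rule T.add T.diff T.zero T.scale)+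
qed

lemma shifted_L: "shifted x a (L y v) = L y (shifted x a v) + L (ad x y) v"
  by (simp add: shifted_def L_ad algebra_simps)

lemma shifted_mem:
  assumes W: "submodule W" and "w \<in> W"
  shows "(shifted x a ^^ k) w \<in> W"
proof (induction k)
  case (Suc k)
  have "L x ((shifted x a ^^ k) w) - scale a ((shifted x a ^^ k) w) \<in> W"
    using Suc submoduleD[OF W] by (intro subspace_diff subspace_scale) auto
  then show ?case by (simp add: shifted_def[of x a "(shifted x a ^^ k) w"])
qed (simp add: assms)

text \<open>By \<open>shifted_L\<close>, each application consumes either one of the
  \<open>k\<close> powers killing \<open>v\<close> or one of the \<open>j\<close> powers of
  \<open>ad x\<close> killing \<open>y\<close>.\<close>

lemma shifted_kernel_L:
  assumes "(shifted x a ^^ k) v = 0" "(ad x ^^ j) y = 0"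
  shows "(shifted x a ^^ (k + j)) (L y v) = 0"
  using assms
proof (induction "k + j" arbitrary: k j v y)
  case 0
  then show ?case by simp
next
  case (Suc n)
  show ?case
  proof (cases "k = 0 \<or> j = 0")
    case True
    then show ?thesis using Suc.prems by auto
  next
    case False
    then obtain k' j' where k: "k = Suc k'" "j = Suc j'" by (metis not0_implies_Suc)
    have "(shifted x a ^^ (k' + j)) (L y (shifted x a v)) = 0"
      using Suc.prems Suc.hyps(2) k by (intro Suc.hyps(1)) (auto simp: funpow_swap1)
    moreover have "(shifted x a ^^ (k + j')) (L (ad x y) v) = 0"
      using Suc.prems Suc.hyps(2) k by (intro Suc.hyps(1)) (auto simp: funpow_swap1)
    moreover have "(shifted x a ^^ (k + j)) (L y v) =
        (shifted x a ^^ (k' + j)) (L y (shifted x a v) + L (ad x y) v)"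
      using k by (simp only: add_Suc funpow_Suc_right o_apply shifted_L)
    moreover have "k' + j = k + j'"
      using k by simp
    ultimately show ?thesis
      by simp
  qed
qed

text \<open>Dual to \<open>shifted_kernel_L\<close>: \<open>L y\<close> passes under the powers of
  the shifted operator and loses at most \<open>j\<close> of them to commutators.\<close>

lemma shifted_image_L:
  assumes W: "submodule W" and "w \<in> W" "(ad x ^^ j) y = 0"
  shows "L y ((shifted x a ^^ (m + j)) w) \<in> (shifted x a ^^ m) ` W"
  using assms(2,3)
proof (induction "m + j" arbitrary: m j w y)
  case 0
  then show ?case by (simp add: submoduleD[OF W] subspace_0)
next
  case (Suc n)
  interpret T: Vector_Spaces.linear scale scale "shifted x a ^^ m"
    by (intro linear_funpow linear_shifted)
  have sub: "subspace ((shifted x a ^^ m) ` W)"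
    by (intro T.subspace_image submoduleD[OF W])
  have inW: "(shifted x a ^^ i) u \<in> W" if "u \<in> W" for i u
    by (rule shifted_mem[OF W that])
  show ?case
  proof (cases "m = 0 \<or> j = 0")
    case True
    then show ?thesis
      using Suc.prems inW submoduleD(2)[OF W] subspace_0[OF submoduleD(1)[OF W]] subspace_0[OF sub]
      by auto
  next
    case False
    then obtain m' j' where k: "m = Suc m'" "j = Suc j'" by (metis not0_implies_Suc)
    have "L y ((shifted x a ^^ (m' + j)) w) \<in> (shifted x a ^^ m') ` W"
      using Suc.prems Suc.hyps(2) k by (intro Suc.hyps(1)) auto
    then have "shifted x a (L y ((shifted x a ^^ (m' + j)) w)) \<in> (shifted x a ^^ m) ` W"
      using k by auto
    moreover have "L (ad x y) ((shifted x a ^^ (m + j')) w) \<in> (shifted x a ^^ m) ` W"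
      using Suc.prems Suc.hyps(2) k by (intro Suc.hyps(1)) (auto simp: funpow_swap1)
    ultimately have "shifted x a (L y ((shifted x a ^^ (m' + j)) w))
        - L (ad x y) ((shifted x a ^^ (m' + j)) w) \<in> (shifted x a ^^ m) ` W"
      using k by (intro subspace_diff[OF sub]) auto
    then show ?thesis
      using k by (simp add: shifted_L)
  qed
qed

definition gen_space :: "('x \<Rightarrow> 'k) \<Rightarrow> 'v set" where
  "gen_space \<alpha> = {v. \<forall>x. \<exists>k. (shifted x (\<alpha> x) ^^ k) v = 0}"

lemma funpow_shifted_mono:
  assumes "(shifted x a ^^ k) v = 0" "k \<le> m"
  shows "(shifted x a ^^ m) v = 0"
  using assms by (metis comp_apply funpow_add le_add_diff_inverse2 shifted_simps(3))

lemma submodule_kernel: "submodule {v. \<exists>k. (shifted x a ^^ k) v = 0}"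
  unfolding submodule_def
proof (intro conjI allI ballI)
  show "subspace {v. \<exists>k. (shifted x a ^^ k) v = 0}"
  proof (rule subspaceI)
    fix u v
    assume "u \<in> {v. \<exists>k. (shifted x a ^^ k) v = 0}" "v \<in> {v. \<exists>k. (shifted x a ^^ k) v = 0}"
    then obtain k l where "(shifted x a ^^ k) u = 0" "(shifted x a ^^ l) v = 0" by blast
    then have "(shifted x a ^^ max k l) u = 0" "(shifted x a ^^ max k l) v = 0"
      by (auto intro: funpow_shifted_mono)
    then have "(shifted x a ^^ max k l) (u + v) = 0" by simp
    then show "u + v \<in> {v. \<exists>k. (shifted x a ^^ k) v = 0}" by blast
  qed (use shifted_simps in auto)
  show "L y w \<in> {v. \<exists>k. (shifted x a ^^ k) v = 0}" if "w \<in> {v. \<exists>k. (shifted x a ^^ k) v = 0}" for y w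
    using that shifted_kernel_L[OF _ ad_nilpotent] by blast
qed

lemma submodule_gen_space: "submodule (gen_space \<alpha>)"
proof -
  have "gen_space \<alpha> = (\<Inter>x. {v. \<exists>k. (shifted x (\<alpha> x) ^^ k) v = 0})"
    by (auto simp: gen_space_def)
  then show ?thesis
    using submodule_kernel unfolding submodule_def by (auto intro!: subspace_Int)
qed

text \<open>If some \<open>L x\<close> has a further eigenvalue on \<open>W\<close> besides \<open>\<alpha> x\<close>, its Fitting decomposition
  splits \<open>W\<close> into two smaller submodules.\<close>

theorem submodule_subset_span_gen_spaces:
  assumes "submodule W"
  shows "W \<subseteq> span (\<Union>\<alpha>\<in>{\<alpha>. \<exists>u. u \<noteq> 0 \<and> (\<forall>x. L x u = scale (\<alpha> x) u)}. gen_space \<alpha>)"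
    (is "W \<subseteq> span ?S")
  using assms
proof (induction "dim W" arbitrary: W rule: less_induct)
  case less
  note W = less.prems
  have subW: "subspace W" by (rule submoduleD(1)[OF W])
  show ?case
  proof (cases "W = {0}")
    case True
    then show ?thesis by (simp add: span_zero)
  next
    case False
    obtain v \<alpha> where v: "v \<in> W" "v \<noteq> 0" "\<And>x. L x v = scale (\<alpha> x) v"
      using common_eigenvector[OF W False] by blast
    show ?thesis
    proof (cases "W \<subseteq> gen_space \<alpha>")
      case True
      then show ?thesis using v by (blast intro: span_base)
    next
      case False
      then obtain x w0 where w0: "w0 \<in> W" "\<And>k. (shifted x (\<alpha> x) ^^ k) w0 \<noteq> 0"
        by (auto simp: gen_space_def)
      define T where "T = shifted x (\<alpha> x)"
      have T: "Vector_Spaces.linear scale scale (T ^^ k)" for k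
        unfolding T_def by (intro linear_funpow linear_shifted)
      have Tv: "T v = 0" by (simp add: T_def shifted_def v(3))
      have inW: "(T ^^ k) w \<in> W" if "w \<in> W" for k w
        unfolding T_def by (rule shifted_mem[OF W that])
      define K where "K = {w \<in> W. \<exists>k. (T ^^ k) w = 0}"
      have K: "submodule K"
        using submodule_kernel[of x "\<alpha> x"] W
        unfolding K_def T_def submodule_def by (auto simp: subspace_def)
      have "K \<subset> W" using w0 by (auto simp: K_def T_def)
      then have IH_K: "K \<subseteq> span ?S"
        using dim_less[OF submoduleD(1)[OF K] subW] by (intro less.hyps K)
      obtain N1 where N1: "\<And>m. m \<ge> N1 \<Longrightarrow> (T ^^ m) ` W = (T ^^ N1) ` W"
      proof -
        have "(T ^^ Suc n) ` W \<subseteq> (T ^^ n) ` W" for n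
          using inW[of _ 1] by (auto simp: funpow_swap1)
        moreover have "subspace ((T ^^ n) ` W)" for n
          using T[of n] subW by (metis linear_image_subspace)
        ultimately show ?thesis
          using descending_subspaces_stable[of "\<lambda>n. (T ^^ n) ` W"] that by blast
      qed
      obtain N2 where N2: "\<And>m. m \<ge> N2 \<Longrightarrow> {w. (T ^^ m) w = 0} = {w. (T ^^ N2) w = 0}"
      proof -
        have "{w. (T ^^ n) w = 0} \<subseteq> {w. (T ^^ Suc n) w = 0}" for n
          unfolding T_def using funpow_shifted_mono[where k = n and m = "Suc n"] by auto
        moreover have "subspace {w. (T ^^ n) w = 0}" for n
          using T[of n] by (rule linear_kernel_subspace)
        ultimately show ?thesis
          using ascending_subspaces_stable[of "\<lambda>n. {w. (T ^^ n) w = 0}"] that by blast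
      qed
      define N where "N = max N1 N2"
      have N: "(T ^^ m) ` W = (T ^^ N) ` W" if "m \<ge> N" for m
        using N1[of m] N1[of N] that by (simp add: N_def)
      define I where "I = (T ^^ N) ` W"
      have I: "submodule I"
        unfolding submodule_def
      proof (intro conjI allI ballI)
        show "subspace I"
          unfolding I_def using T[of N] subW by (metis linear_image_subspace)
        show "L y w \<in> I" if "w \<in> I" for y w
        proof -
          \<comment> \<open>Stability of the images supplies \<open>cl\<close> spare powers of
            \<open>T\<close>, as many as \<open>shifted_image_L\<close> may lose.\<close>
          have "w \<in> (T ^^ (N + cl)) ` W"
            using that N[of "N + cl"] unfolding I_def by simp
          then obtain u where "u \<in> W" "w = (T ^^ (N + cl)) u"
            by blast
          then show ?thesis
            using shifted_image_L[OF W \<open>u \<in> W\<close> ad_nilpotent, where y = y and x = x and a = "\<alpha> x" and m = N] by (simp add: I_def T_def)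
        qed
      qed
      \<comment> \<open>The kernel of \<open>T\<close> meets the stable image only in 0, so the
        eigenvector \<open>v\<close> shows that \<open>I\<close> is proper.\<close>
      have "v \<notin> I"
      proof
        assume "v \<in> I"
        then obtain u where u: "v = (T ^^ N) u" by (auto simp: I_def)
        then have "(T ^^ Suc N) u = 0" using Tv by simp
        moreover have "{w. (T ^^ Suc N) w = 0} = {w. (T ^^ N) w = 0}"
          using N2[of "Suc N"] N2[of N] by (simp only: N_def max.cobounded2 le_SucI)
        ultimately have "(T ^^ N) u = 0" by blast
        then show False using u v(2) by simp
      qed
      moreover have "I \<subseteq> W" using inW by (auto simp: I_def)
      ultimately have "I \<subset> W" using v(1) by blast
      then have IH_I: "I \<subseteq> span ?S"
        using dim_less[OF submoduleD(1)[OF I] subW] by (intro less.hyps I)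
      show ?thesis
      proof
        fix w
        assume w: "w \<in> W"
        then have "(T ^^ N) w \<in> (T ^^ N) ` W" by blast
        then have "(T ^^ N) w \<in> (T ^^ (N + N)) ` W" using N[of "N + N"] by simp
        then obtain u where u: "u \<in> W" "(T ^^ N) w = (T ^^ (N + N)) u" by blast
        have "(T ^^ N) (w - (T ^^ N) u) = 0"
          using u(2) by (simp add: T_def funpow_add)
        then have "w - (T ^^ N) u \<in> K"
          using w u(1) inW subspace_diff[OF subW] by (auto simp: K_def)
        moreover have "(T ^^ N) u \<in> I" using u(1) by (simp add: I_def)
        ultimately have "(w - (T ^^ N) u) + (T ^^ N) u \<in> span ?S"
          using IH_K IH_I by (intro span_add) auto
        then show "w \<in> span ?S" by simp
      qed
    qed
  qed
qed

end

section \<open>Post-Lie structures\<close>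

declare plus_fun_apply [simp del] zero_fun_apply [simp del] minus_apply [simp del] uminus_apply [simp del]

lemma sum_fun_apply: "(\<Sum>i\<in>A. f i) x = (\<Sum>i\<in>A. f i x)"
  by (induction A rule: infinite_finite_induct) (simp_all add: plus_fun_apply zero_fun_apply)

section \<open>Rational functionals on the weights and the elimination order\<close>

lemma ex_linear_functional:
  fixes scale :: "'k::field \<Rightarrow> 'v::ab_group_add \<Rightarrow> 'v"
  assumes "vector_space scale" "b \<noteq> 0"
  obtains f where "\<And>u v. f (u + v) = f u + f v" "\<And>c u. f (scale c u) = c * f u" "f b \<noteq> (0 :: 'k)"
proof -
  have "vector_space_pair scale ((*) :: 'k \<Rightarrow> 'k \<Rightarrow> 'k)"
    using assms(1) by (simp add: vector_space_pair_def vector_space_def algebra_simps)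
  then interpret vp: vector_space_pair scale "(*) :: 'k \<Rightarrow> 'k \<Rightarrow> 'k" .
  have "\<not> vp.vs1.dependent {b}"
    using assms(2) by (simp add: vp.vs1.dependent_single)
  from vp.linear_independent_extend[OF this, of "\<lambda>_. 1"] obtain f
    where f: "Vector_Spaces.linear scale (*) f" "f b = 1" by auto
  interpret f: Vector_Spaces.linear scale "(*)" f by fact
  show ?thesis
    by (rule that[of f]) (simp_all add: f.add f.scale f(2))
qed

text \<open>Characteristic 0 makes the space a rational vector space, so some \<open>g\<close> is
  nonzero at the new point. If \<open>f\<close> vanishes there, \<open>t * f + g\<close> works once
  \<open>t\<close> avoids the finitely many ratios that would produce a zero on
  \<open>A\<close>.\<close>

lemma ex_additive_nonvanishing:
  fixes A :: "('n \<Rightarrow> 'k::field_char_0) set"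
  assumes "finite A" "0 \<notin> A"
  shows "\<exists>f :: ('n \<Rightarrow> 'k) \<Rightarrow> rat. (\<forall>u v. f (u + v) = f u + f v) \<and> (\<forall>x\<in>A. f x \<noteq> 0)"
  using assms
proof (induction A rule: finite_induct)
  case empty
  show ?case by (intro exI[of _ "\<lambda>_. 0"]) simp
next
  case (insert x A)
  then have "\<exists>f :: ('n \<Rightarrow> 'k) \<Rightarrow> rat. (\<forall>u v. f (u + v) = f u + f v) \<and> (\<forall>x\<in>A. f x \<noteq> 0)"
    by blast
  then obtain f :: "('n \<Rightarrow> 'k) \<Rightarrow> rat"
    where f: "\<And>u v. f (u + v) = f u + f v" "\<And>x. x \<in> A \<Longrightarrow> f x \<noteq> 0" by blast
  show ?case
  proof (cases "f x = 0")
    case False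
    then show ?thesis using f by blast
  next
    case True
    have "vector_space (\<lambda>q v i. of_rat q * v i :: 'k)"
      by (simp add: vector_space_def fun_eq_iff plus_fun_apply algebra_simps of_rat_add of_rat_mult)
    moreover have "x \<noteq> 0" using insert.prems by auto
    ultimately obtain g :: "('n \<Rightarrow> 'k) \<Rightarrow> rat" where g: "\<And>u v. g (u + v) = g u + g v" "g x \<noteq> 0"
      by (rule ex_linear_functional) blast
    obtain t where t: "t \<notin> (\<lambda>y. - g y / f y) ` A"
      using ex_new_if_finite[OF infinite_UNIV_char_0] insert.hyps(1) by blast
    have "t * f y + g y \<noteq> 0" if "y \<in> insert x A" for y
    proof (cases "y = x")
      case False
      then have "y \<in> A" using that by simp
      then have "t \<noteq> - g y / f y" using t by blast
      then show ?thesis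
        using f(2)[OF \<open>y \<in> A\<close>] by (auto simp: field_simps add_eq_0_iff)
    qed (simp add: True g(2))
    then show ?thesis
      by (intro exI[of _ "\<lambda>y. t * f y + g y"]) (auto simp: f(1) g(1) algebra_simps)
  qed
qed

text \<open>The order in which Kreknin's argument eliminates weights: positive ones before negative
  ones, each in increasing order.\<close>

lemma neg_inverse_order:
  fixes p q :: "'a::linordered_field"
  assumes "p \<noteq> 0" "q \<noteq> 0" "p + q \<noteq> 0" "- inverse (p + q) < - inverse q"
  shows "- inverse (p + q) < - inverse p"
proof -
  have 1: "inverse q < inverse (p + q)" using assms by simp
  have "inverse p < inverse (p + q)"
  proof (cases "0 < p + q")
    case True
    show ?thesis
    proof (cases "0 < p")
      case p: True
      have "\<not> 0 < q"
      proof
        assume "0 < q"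
        with p have "inverse (p + q) < inverse q" by (intro less_imp_inverse_less) auto
        with 1 show False by simp
      qed
      then have "p + q < p" using assms(2) by simp
      then show ?thesis using True by (intro less_imp_inverse_less)
    next
      case False
      then have "inverse p < 0" using assms(1) by simp
      also have "0 < inverse (p + q)" using True by simp
      finally show ?thesis .
    qed
  next
    \<comment> \<open>For a negative sum the weights coming later are the negative ones closer to 0;
      if \<open>q\<close> is one of them, \<open>p\<close> is one too.\<close>
    case False
    then have neg: "p + q < 0" using assms(3) by simp
    have "inverse (p + q) < 0" using neg by simp
    with 1 have "inverse q < 0" by (rule less_trans)
    then have "q < 0" by simp
    have "p < 0"
    proof (rule ccontr)
      assume "\<not> p < 0"
      then have "q < p + q" using assms(1) by simp
      then have "inverse (p + q) < inverse q" using neg by (intro less_imp_inverse_less_neg)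
      with 1 show False by simp
    qed
    then show ?thesis
      using \<open>q < 0\<close> by (intro less_imp_inverse_less_neg) auto
  qed
  then show ?thesis by simp
qed

subsection \<open>Coordinates\<close>

lemma vadd_eq_plus: "vadd = (+)"
  by (simp add: vadd_def fun_eq_iff plus_fun_apply)

lemma vzero_eq_0: "vzero = 0"
  by (simp add: vzero_def fun_eq_iff zero_fun_apply)

lemma vdiff_eq_minus: "vdiff = (-)"
  by (simp add: vdiff_def fun_eq_iff minus_apply)

lemma vscale_apply: "vscale c v i = c * v i"
  by (simp add: vscale_def)

lemmas vec_apply = plus_fun_apply zero_fun_apply minus_apply uminus_apply vscale_apply sum_fun_apply

lemma inj_basis_vec: "inj (basis_vec :: 'n \<Rightarrow> 'n \<Rightarrow> 'a::field)"
  by (rule injI) (metis basis_vec_def zero_neq_one)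

lemma basis_expansion:
  fixes v :: "'n::finite \<Rightarrow> 'a::field"
  shows "v = (\<Sum>i\<in>UNIV. vscale (v i) (basis_vec i))"
  by (simp add: fun_eq_iff vec_apply basis_vec_def if_distrib cong: if_cong)

interpretation fv: finite_dimensional_vector_space
  "vscale :: 'a::field \<Rightarrow> ('n::finite \<Rightarrow> 'a) \<Rightarrow> 'n \<Rightarrow> 'a" "range basis_vec"
proof -
  interpret vector_space "vscale :: 'a::field \<Rightarrow> ('n::finite \<Rightarrow> 'a) \<Rightarrow> 'n \<Rightarrow> 'a"
    by standard (simp_all add: fun_eq_iff vec_apply algebra_simps)
  have "independent (range (basis_vec :: 'n \<Rightarrow> 'n \<Rightarrow> 'a))"
  proof (rule independent_if_scalars_zero)
    fix f :: "('n \<Rightarrow> 'a) \<Rightarrow> 'a" and x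
    assume "(\<Sum>x\<in>range basis_vec. vscale (f x) x) = 0" "x \<in> range (basis_vec :: 'n \<Rightarrow> 'n \<Rightarrow> 'a)"
    then obtain k where k: "x = basis_vec k" "(\<Sum>i\<in>UNIV. vscale (f (basis_vec i)) (basis_vec i)) = 0"
      by (auto simp: sum.reindex[OF inj_basis_vec])
    have "(\<Sum>i\<in>UNIV. vscale (f (basis_vec i)) (basis_vec i)) k = f x"
    proof -
      have "vscale (f (basis_vec i)) (basis_vec i) k = (if i = k then f x else 0)" for i
        by (auto simp: vscale_apply basis_vec_def k(1))
      then show ?thesis by (simp add: sum_fun_apply)
    qed
    with k(2) show "f x = 0" by (simp add: vec_apply)
  qed simp
  moreover have "v \<in> span (range basis_vec)" for v :: "'n \<Rightarrow> 'a"
    by (subst basis_expansion) (intro span_sum span_scale span_base, simp)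
  ultimately show "finite_dimensional_vector_space (vscale :: 'a \<Rightarrow> ('n \<Rightarrow> 'a) \<Rightarrow> 'n \<Rightarrow> 'a) (range basis_vec)"
    by unfold_locales auto
qed

lemma lsubspace_eq_subspace: "lsubspace (W :: ('n::finite \<Rightarrow> 'a::field) set) \<longleftrightarrow> fv.subspace W"
  by (simp add: lsubspace_def fv.subspace_def vzero_eq_0 vadd_eq_plus)

lemma lspan_eq_span: "lspan (S :: ('n::finite \<Rightarrow> 'a::field) set) = fv.span S"
  by (simp add: lspan_def fv.span_def hull_def lsubspace_eq_subspace)

lemma bilinear_opD:
  assumes "bilinear_op B"
  shows "B (u + v) w = B u w + B v w" "B w (u + v) = B w u + B w v"
    "B (vscale c u) w = vscale c (B u w)" "B w (vscale c u) = vscale c (B w u)"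
  using assms by (simp_all add: bilinear_op_def vadd_eq_plus)

lemma linear_bilinear_op:
  fixes B :: "('n::finite \<Rightarrow> 'a::field) \<Rightarrow> ('n \<Rightarrow> 'a) \<Rightarrow> ('n \<Rightarrow> 'a)"
  assumes "bilinear_op B"
  shows "Vector_Spaces.linear vscale vscale (B u)" "Vector_Spaces.linear vscale vscale (\<lambda>u. B u v)"
  using fv.vector_space_axioms by (simp_all add: Vector_Spaces.linear_iff bilinear_opD[OF assms])

lemma linear_expansion:
  fixes f :: "('n::finite \<Rightarrow> 'a::field) \<Rightarrow> ('n \<Rightarrow> 'a)"
  assumes "Vector_Spaces.linear vscale vscale f"
  shows "f v k = (\<Sum>i\<in>UNIV. v i * f (basis_vec i) k)"
proof -
  interpret f: Vector_Spaces.linear vscale vscale f by fact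
  have "f v = (\<Sum>i\<in>UNIV. vscale (v i) (f (basis_vec i)))"
    by (subst basis_expansion[of v]) (simp only: f.sum f.scale)
  then show ?thesis by (simp add: vec_apply)
qed

lemma bilinear_op_expansion:
  fixes B :: "('n::finite \<Rightarrow> 'a::field) \<Rightarrow> ('n \<Rightarrow> 'a) \<Rightarrow> ('n \<Rightarrow> 'a)"
  assumes "bilinear_op B"
  shows "B u v k = (\<Sum>i\<in>UNIV. \<Sum>j\<in>UNIV. u i * v j * B (basis_vec i) (basis_vec j) k)"
  using linear_expansion[OF linear_bilinear_op(2)[OF assms], of u v k]
    linear_expansion[OF linear_bilinear_op(1)[OF assms], of _ v k]
  by (simp add: sum_distrib_left mult.assoc)

lemma linear_eq_0_on_basis:
  fixes f :: "('n::finite \<Rightarrow> 'a::field) \<Rightarrow> ('n \<Rightarrow> 'a)"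
  assumes "Vector_Spaces.linear vscale vscale f" "\<And>i. f (basis_vec i) = 0"
  shows "f x = 0"
proof -
  interpret f: Vector_Spaces.linear vscale vscale f by fact
  show ?thesis
    using f.eq_0_on_span[of "range basis_vec" x] assms(2) by (auto simp: fv.span_Basis)
qed

subsection \<open>Extension of scalars\<close>

definition emb :: "('n \<Rightarrow> 'a::field) \<Rightarrow> 'n \<Rightarrow> 'a alg_closure" where
  "emb v = (\<lambda>i. to_ac (v i))"

lemma emb_simps [simp]:
  "emb (u + v) = emb u + emb v" "emb (u - v) = emb u - emb v" "emb (- u) = - emb u" "emb 0 = 0"
  "emb (vscale c u) = vscale (to_ac c) (emb u)" "emb (basis_vec i) = basis_vec i"
  "emb u = 0 \<longleftrightarrow> u = 0"
  by (auto simp: emb_def fun_eq_iff basis_vec_def vec_apply)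

lemma bilinear_op_ext_prod: "bilinear_op (ext_prod B)"
  by (auto simp: bilinear_op_def ext_prod_def vadd_def vscale_def fun_eq_iff sum_distrib_left
      sum.distrib algebra_simps)

lemmas ext_prod_simps [simp] = bilinear_opD[OF bilinear_op_ext_prod]

lemma ext_prod_emb:
  assumes "bilinear_op B"
  shows "ext_prod B (emb u) (emb v) = emb (B u v)"
  by (rule ext) (simp add: ext_prod_def emb_def bilinear_op_expansion[OF assms, of u v] to_ac_sum)

lemma ext_prod_basis:
  assumes "bilinear_op B"
  shows "ext_prod B (basis_vec i) (basis_vec j) = emb (B (basis_vec i) (basis_vec j))"
  using ext_prod_emb[OF assms, of "basis_vec i" "basis_vec j"] by simp

lemma ext_prod_zero [simp]: "ext_prod B 0 x = 0" "ext_prod B x 0 = 0"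
  by (simp_all add: ext_prod_def fun_eq_iff vec_apply)

lemma ext_prod_minus [simp]: "ext_prod B x (- y) = - ext_prod B x y"
proof -
  have "ext_prod B x (- y) + ext_prod B x y = 0"
    by (simp flip: ext_prod_simps(2))
  then show ?thesis by (simp add: eq_neg_iff_add_eq_0)
qed

lemma bilinear_eq_0_on_basis:
  fixes f :: "('n::finite \<Rightarrow> 'a::field) \<Rightarrow> ('n \<Rightarrow> 'a) \<Rightarrow> ('n \<Rightarrow> 'a)"
  assumes "\<And>y. Vector_Spaces.linear vscale vscale (\<lambda>x. f x y)"
    and "\<And>x. Vector_Spaces.linear vscale vscale (\<lambda>y. f x y)"
    and "\<And>i j. f (basis_vec i) (basis_vec j) = 0"
  shows "f x y = 0"
  by (rule linear_eq_0_on_basis[OF assms(1)], rule linear_eq_0_on_basis[OF assms(2)], rule assms(3))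

text \<open>Transfers identities to the closure: on basis vectors the extended products are images
  under \<open>emb\<close> of products over K.\<close>

lemma trilinear_eq_0_on_basis:
  fixes f :: "('n::finite \<Rightarrow> 'a::field) \<Rightarrow> ('n \<Rightarrow> 'a) \<Rightarrow> ('n \<Rightarrow> 'a) \<Rightarrow> ('n \<Rightarrow> 'a)"
  assumes "\<And>y z. Vector_Spaces.linear vscale vscale (\<lambda>x. f x y z)"
    and "\<And>x z. Vector_Spaces.linear vscale vscale (\<lambda>y. f x y z)"
    and "\<And>x y. Vector_Spaces.linear vscale vscale (\<lambda>z. f x y z)"
    and "\<And>i j k. f (basis_vec i) (basis_vec j) (basis_vec k) = 0"
  shows "f x y z = 0"
  by (rule linear_eq_0_on_basis[OF assms(1)], rule bilinear_eq_0_on_basis[OF assms(2,3)], rule assms(4))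

text \<open>The law \<open>N u u = 0\<close> is quadratic, so it is first polarized into a bilinear
  identity, which can be checked on the basis.\<close>

lemma ext_prod_skew:
  assumes "lie_algebra N"
  shows "ext_prod N x y = - ext_prod N y x"
proof -
  have N: "bilinear_op N" and alt: "N u u = 0" for u
    using assms by (auto simp: lie_algebra_def vzero_eq_0)
  have sk: "N u v + N v u = 0" for u v
    using alt[of "u + v"] unfolding bilinear_opD[OF N] by (simp only: alt add_0_left add_0_right add.commute)
  have "ext_prod N x y + ext_prod N y x = 0"
  proof (rule bilinear_eq_0_on_basis[where f = "\<lambda>x y. ext_prod N x y + ext_prod N y x"])
    show "ext_prod N (basis_vec i) (basis_vec j) + ext_prod N (basis_vec j) (basis_vec i) = 0" for i j
      by (simp add: ext_prod_basis[OF N] sk flip: emb_simps(1))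
  qed (use fv.vector_space_axioms in \<open>simp_all add: Vector_Spaces.linear_iff fv.scale_right_distrib\<close>)
  then show ?thesis by (simp add: eq_neg_iff_add_eq_0)
qed

lemma ext_prod_jacobi:
  assumes "lie_algebra N"
  shows "ext_prod N x (ext_prod N y z) = ext_prod N (ext_prod N x y) z + ext_prod N y (ext_prod N x z)"
proof -
  let ?N = "ext_prod N"
  have N: "bilinear_op N" and cyc: "N u (N v w) + (N v (N w u) + N w (N u v)) = 0" for u v w
    using assms by (auto simp: lie_algebra_def vzero_eq_0 vadd_eq_plus)
  have "?N x (?N y z) + (?N y (?N z x) + ?N z (?N x y)) = 0"
  proof (rule trilinear_eq_0_on_basis[where f = "\<lambda>x y z. ?N x (?N y z) + (?N y (?N z x) + ?N z (?N x y))"])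
    show "?N (basis_vec i) (?N (basis_vec j) (basis_vec k)) +
        (?N (basis_vec j) (?N (basis_vec k) (basis_vec i)) +
         ?N (basis_vec k) (?N (basis_vec i) (basis_vec j))) = 0" for i j k
      using ext_prod_emb[OF N, of "basis_vec i" "N (basis_vec j) (basis_vec k)"]
        ext_prod_emb[OF N, of "basis_vec j" "N (basis_vec k) (basis_vec i)"]
        ext_prod_emb[OF N, of "basis_vec k" "N (basis_vec i) (basis_vec j)"]
      by (simp add: ext_prod_basis[OF N] cyc flip: emb_simps(1))
  qed (use fv.vector_space_axioms in \<open>simp_all add: Vector_Spaces.linear_iff fv.scale_right_distrib\<close>)
  moreover have "?N y (?N z x) = - ?N y (?N x z)"
    using ext_prod_skew[OF assms, of z x] by simp
  moreover have "?N z (?N x y) = - ?N (?N x y) z"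
    by (rule ext_prod_skew[OF assms])
  ultimately show ?thesis by (simp add: add_eq_0_iff algebra_simps)
qed

lemma post_lie_structureD:
  assumes "post_lie_structure G N P"
  shows "bilinear_op P" "P (G x y) z = P x (P y z) - P y (P x z)"
    "P x (N y z) = N (P x y) z + N y (P x z)"
  using assms by (simp_all add: post_lie_structure_def vadd_eq_plus vdiff_eq_minus)

lemma ext_prod_action:
  assumes G: "bilinear_op G" and P: "post_lie_structure G N P"
  shows "ext_prod P (ext_prod G x y) z =
    ext_prod P x (ext_prod P y z) - ext_prod P y (ext_prod P x z)"
proof -
  note bP = post_lie_structureD(1)[OF P]
  have "ext_prod P (ext_prod G x y) z -
      (ext_prod P x (ext_prod P y z) - ext_prod P y (ext_prod P x z)) = 0"
  proof (rule trilinear_eq_0_on_basis[where f = "\<lambda>x y z. ext_prod P (ext_prod G x y) z -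
      (ext_prod P x (ext_prod P y z) - ext_prod P y (ext_prod P x z))"])
    show "ext_prod P (ext_prod G (basis_vec i) (basis_vec j)) (basis_vec k) -
      (ext_prod P (basis_vec i) (ext_prod P (basis_vec j) (basis_vec k)) -
       ext_prod P (basis_vec j) (ext_prod P (basis_vec i) (basis_vec k))) = 0" for i j k
      using ext_prod_emb[OF bP, of "G (basis_vec i) (basis_vec j)" "basis_vec k"]
        ext_prod_emb[OF bP, of "basis_vec i" "P (basis_vec j) (basis_vec k)"]
        ext_prod_emb[OF bP, of "basis_vec j" "P (basis_vec i) (basis_vec k)"]
      by (simp add: ext_prod_basis[OF bP] ext_prod_basis[OF G] post_lie_structureD(2)[OF P])
  qed (use fv.vector_space_axioms in \<open>simp_all add: Vector_Spaces.linear_iff fv.scale_right_distrib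
      fv.scale_right_diff_distrib\<close>)
  then show ?thesis by simp
qed

lemma ext_prod_derivation:
  assumes N: "bilinear_op N" and P: "post_lie_structure G N P"
  shows "ext_prod P x (ext_prod N y z) =
    ext_prod N (ext_prod P x y) z + ext_prod N y (ext_prod P x z)"
proof -
  note bP = post_lie_structureD(1)[OF P]
  have "ext_prod P x (ext_prod N y z) -
      (ext_prod N (ext_prod P x y) z + ext_prod N y (ext_prod P x z)) = 0"
  proof (rule trilinear_eq_0_on_basis[where f = "\<lambda>x y z. ext_prod P x (ext_prod N y z) -
      (ext_prod N (ext_prod P x y) z + ext_prod N y (ext_prod P x z))"])
    show "ext_prod P (basis_vec i) (ext_prod N (basis_vec j) (basis_vec k)) -
      (ext_prod N (ext_prod P (basis_vec i) (basis_vec j)) (basis_vec k) +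
       ext_prod N (basis_vec j) (ext_prod P (basis_vec i) (basis_vec k))) = 0" for i j k
      using ext_prod_emb[OF bP, of "basis_vec i" "N (basis_vec j) (basis_vec k)"]
        ext_prod_emb[OF N, of "P (basis_vec i) (basis_vec j)" "basis_vec k"]
        ext_prod_emb[OF N, of "basis_vec j" "P (basis_vec i) (basis_vec k)"]
      by (simp add: ext_prod_basis[OF bP] ext_prod_basis[OF N] post_lie_structureD(3)[OF P])
  qed (use fv.vector_space_axioms in \<open>simp_all add: Vector_Spaces.linear_iff fv.scale_right_distrib
      fv.scale_right_diff_distrib\<close>)
  then show ?thesis by simp
qed

section \<open>Lower central series under extension of scalars\<close>

lemma lcs_SucI:
  fixes B :: "('n::finite \<Rightarrow> 'a::field) \<Rightarrow> ('n \<Rightarrow> 'a) \<Rightarrow> ('n \<Rightarrow> 'a)"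
  shows "y \<in> lcs B i \<Longrightarrow> B x y \<in> lcs B (Suc i)"
  unfolding lcs.simps lspan_eq_span by (rule fv.span_base) blast

lemma zero_mem_lcs: "(0 :: 'n::finite \<Rightarrow> 'a::field) \<in> lcs B k"
  by (cases k) (simp_all add: lspan_eq_span fv.span_zero)

text \<open>Since \<open>emb\<close> is injective, this brings the vanishing of a term of the series
  back from the closure to K.\<close>

lemma emb_lcs:
  fixes B :: "('n::finite \<Rightarrow> 'a::field) \<Rightarrow> ('n \<Rightarrow> 'a) \<Rightarrow> ('n \<Rightarrow> 'a)"
  assumes "bilinear_op B" "v \<in> lcs B k"
  shows "emb v \<in> lcs (ext_prod B) k"
  using assms(2)
proof (induction k arbitrary: v)
  case (Suc k)
  have "fv.subspace {v. emb v \<in> lcs (ext_prod B) (Suc k)}"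
    unfolding lcs.simps lspan_eq_span
    by (auto simp: fv.subspace_def intro: fv.span_zero fv.span_add fv.span_scale)
  moreover have "emb (B x y) \<in> lcs (ext_prod B) (Suc k)" if "y \<in> lcs B k" for x y
    using lcs_SucI[OF Suc.IH[OF that], of "emb x"] ext_prod_emb[OF assms(1)] by simp
  then have "{B x y |x y. y \<in> lcs B k} \<subseteq> {v. emb v \<in> lcs (ext_prod B) (Suc k)}" by blast
  ultimately have "lcs B (Suc k) \<subseteq> {v. emb v \<in> lcs (ext_prod B) (Suc k)}"
    by (simp only: lcs.simps(2)[of B] lspan_eq_span fv.span_minimal)
  with Suc.prems show ?case by blast
qed simp

text \<open>Carries nilpotency of \<open>G\<close> up to the closure. By bilinearity the factors may
  be taken from the basis and from the embedded previous term.\<close>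

lemma lcs_ext_prod_subset:
  fixes B :: "('n::finite \<Rightarrow> 'a::field) \<Rightarrow> ('n \<Rightarrow> 'a) \<Rightarrow> ('n \<Rightarrow> 'a)"
  assumes B: "bilinear_op B"
  shows "lcs (ext_prod B) k \<subseteq> fv.span (emb ` lcs B k)"
proof (induction k)
  case 0
  have "range basis_vec \<subseteq> range (emb :: ('n \<Rightarrow> 'a) \<Rightarrow> _)"
    by (metis emb_simps(6) image_subsetI rangeI)
  from fv.span_mono[OF this] show ?case unfolding fv.span_Basis lcs.simps .
next
  case (Suc k)
  let ?S = "fv.span (emb ` lcs B (Suc k))"
  have 1: "ext_prod B (basis_vec i) y \<in> ?S" if "y \<in> fv.span (emb ` lcs B k)" for i y
    using that
  proof (induction rule: fv.span_induct)
    case base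
    show ?case
      by (auto simp: fv.subspace_def intro: fv.span_zero fv.span_add fv.span_scale)
  next
    case (step a)
    then obtain w where "w \<in> lcs B k" "a = emb w" by blast
    then show ?case
      using ext_prod_emb[OF B, of "basis_vec i" w] lcs_SucI[of w B k "basis_vec i"]
      by (auto intro: fv.span_base simp del: lcs.simps)
  qed
  have "ext_prod B x y \<in> ?S" if y: "y \<in> fv.span (emb ` lcs B k)" for x y
  proof -
    have "x \<in> fv.span (range basis_vec)" by (simp add: fv.span_Basis)
    then show ?thesis
    proof (induction rule: fv.span_induct)
      case base
      show ?case
        by (auto simp: fv.subspace_def intro: fv.span_zero fv.span_add fv.span_scale)
    qed (use 1 y in auto)
  qed
  then show ?case
    unfolding lcs.simps(2)[of "ext_prod B"] lspan_eq_span
    using Suc.IH by (intro fv.span_minimal) auto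
qed

lemma nilpotent_rep_ext_prod:
  fixes G N P :: "('n::finite \<Rightarrow> 'a::field_char_0) \<Rightarrow> ('n \<Rightarrow> 'a) \<Rightarrow> ('n \<Rightarrow> 'a)"
  assumes G: "bilinear_op G" and c: "lcs G c = {vzero}" and P: "post_lie_structure G N P"
  shows "nilpotent_rep vscale (range basis_vec) (ext_prod P) (ext_prod G) (lcs (ext_prod G)) c"
proof -
  have "lcs (ext_prod G) c \<subseteq> {0}"
    using lcs_ext_prod_subset[OF G, of c] c by (simp add: vzero_eq_0)
  then have "lcs (ext_prod G) c = {0}" using zero_mem_lcs by blast
  then show ?thesis
    by unfold_locales (auto simp: ext_prod_action[OF G P] lcs_SucI simp del: lcs.simps(2))
qed

subsection \<open>The weight grading\<close>

locale pa_structure =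
  fixes G N P :: "('n::finite \<Rightarrow> 'a::field_char_0) \<Rightarrow> ('n \<Rightarrow> 'a) \<Rightarrow> ('n \<Rightarrow> 'a)" and c :: nat
  assumes G: "lie_algebra G" and N: "lie_algebra N" and P: "post_lie_structure G N P"
    and lcs_G: "lcs G c = {vzero}"
begin

lemma bilinear_G: "bilinear_op G" and bilinear_N: "bilinear_op N" and bilinear_P: "bilinear_op P"
  using G N P by (auto simp: lie_algebra_def post_lie_structure_def)

sublocale rep: nilpotent_rep vscale "range basis_vec" "ext_prod P" "ext_prod G" "lcs (ext_prod G)" c
  by (rule nilpotent_rep_ext_prod[OF bilinear_G lcs_G P])

sublocale lie: lie_bracket vscale "ext_prod N"
  by unfold_locales (rule ext_prod_simps ext_prod_skew[OF N] ext_prod_jacobi[OF N])+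

lemma gen_weight_space_eq: "gen_weight_space P \<alpha> = rep.gen_space (lin_form_app \<alpha>)"
proof -
  have "(\<lambda>w i. ext_prod P x w i - lin_form_app \<alpha> x * w i) = rep.shifted x (lin_form_app \<alpha> x)" for x
    by (intro ext) (simp only: rep.shifted_def minus_apply vscale_apply)
  moreover have "(\<lambda>i. 0) = (0 :: 'n \<Rightarrow> 'a alg_closure)"
    by (simp add: fun_eq_iff zero_fun_apply)
  ultimately show ?thesis
    by (simp only: gen_weight_space_def rep.gen_space_def)
qed

lemma lin_form_app_add: "lin_form_app (\<alpha> + \<beta>) x = lin_form_app \<alpha> x + lin_form_app \<beta> x"
  by (simp add: lin_form_app_def plus_fun_apply distrib_right sum.distrib)

lemma lin_form_app_basis: "lin_form_app \<alpha> (basis_vec i) = \<alpha> i"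
  by (simp add: lin_form_app_def basis_vec_def if_distrib cong: if_cong)

lemma weights_iff: "\<alpha> \<in> weights P \<longleftrightarrow> gen_weight_space P \<alpha> \<noteq> {0}"
proof -
  have "(\<lambda>i. 0) = (0 :: 'n \<Rightarrow> 'a alg_closure)"
    by (simp add: fun_eq_iff zero_fun_apply)
  then show ?thesis by (simp only: weights_def mem_Collect_eq)
qed

lemma subspace_gen_weight_space: "fv.subspace (gen_weight_space P \<alpha>)"
  unfolding gen_weight_space_eq by (rule rep.submoduleD(1)[OF rep.submodule_gen_space])

text \<open>A weight is determined by its values on the basis, and each value is an eigenvalue of
  that basis vector's action: the last nonzero iterate of the shifted operator on a weight vector is
  an eigenvector.\<close>

lemma finite_weights: "finite (weights P)"
proof -
  define S where "S i = {a. \<exists>v. v \<noteq> 0 \<and> ext_prod P (basis_vec i) v = vscale a v}" for i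
  have "\<alpha> i \<in> S i" if \<alpha>: "\<alpha> \<in> weights P" for \<alpha> i
  proof -
    obtain v where v: "v \<in> rep.gen_space (lin_form_app \<alpha>)" "v \<noteq> 0"
      using \<alpha> fv.subspace_0[OF subspace_gen_weight_space] unfolding weights_iff gen_weight_space_eq by blast
    let ?T = "rep.shifted (basis_vec i) (\<alpha> i)"
    have "\<exists>k. (?T ^^ k) v = 0"
      using v(1) unfolding rep.gen_space_def mem_Collect_eq by (metis lin_form_app_basis)
    then obtain k where k: "(?T ^^ k) v = 0" "\<And>j. j < k \<Longrightarrow> (?T ^^ j) v \<noteq> 0"
      using exists_least_iff[of "\<lambda>k. (?T ^^ k) v = 0"] by blast
    obtain j where j: "k = Suc j" using k(1) v(2) by (cases k) auto
    have "(?T ^^ j) v \<noteq> 0" using k(2) j by simp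
    moreover have "ext_prod P (basis_vec i) ((?T ^^ j) v) = vscale (\<alpha> i) ((?T ^^ j) v)"
      using k(1) unfolding j funpow.simps o_apply
      by (simp add: rep.shifted_def[of "basis_vec i" "\<alpha> i" "(?T ^^ j) v"])
    ultimately show ?thesis unfolding S_def by blast
  qed
  then have "weights P \<subseteq> PiE UNIV S" by (auto simp: PiE_def)
  moreover have "finite (PiE UNIV S)"
    unfolding S_def by (intro finite_PiE fv.finite_eigenvalues[OF rep.L_linear]) simp
  ultimately show ?thesis by (rule finite_subset)
qed

text \<open>The abstract decomposition yields functions \<open>\<alpha>\<close> with a common
  eigenvector \<open>u\<close>. As the action is linear in \<open>x\<close> and \<open>u\<close> is
  nonzero, \<open>\<alpha>\<close> is a linear form, given by its values on the basis.\<close>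

lemma span_gen_weight_spaces: "fv.span (\<Union>\<alpha>. gen_weight_space P \<alpha>) = UNIV"
proof -
  have "rep.gen_space \<alpha> \<subseteq> (\<Union>\<alpha>. gen_weight_space P \<alpha>)"
    if u: "u \<noteq> 0" "\<And>x. ext_prod P x u = vscale (\<alpha> x) u" for \<alpha> u
  proof -
    define \<beta> where "\<beta> i = \<alpha> (basis_vec i)" for i
    have "\<alpha> x = lin_form_app \<beta> x" for x
    proof -
      interpret l: Vector_Spaces.linear vscale vscale "\<lambda>x. ext_prod P x u"
        by (rule linear_bilinear_op(2)[OF bilinear_op_ext_prod])
      have "vscale (\<alpha> x) u = ext_prod P (\<Sum>i\<in>UNIV. vscale (x i) (basis_vec i)) u"
        by (simp only: u(2)[symmetric] basis_expansion[symmetric])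
      also have "\<dots> = (\<Sum>i\<in>UNIV. vscale (x i) (ext_prod P (basis_vec i) u))"
        by (simp only: l.sum l.scale)
      also have "\<dots> = (\<Sum>i\<in>UNIV. vscale (x i) (vscale (\<beta> i) u))"
        by (simp only: u(2) \<beta>_def)
      also have "\<dots> = vscale (lin_form_app \<beta> x) u"
        by (simp add: lin_form_app_def fv.scale_sum_left mult.commute)
      finally show ?thesis using u(1) by (simp only: fv.scale_cancel_right)  simp
    qed
    then have "\<alpha> = lin_form_app \<beta>" by (rule ext)
    then show ?thesis by (auto simp: gen_weight_space_eq)
  qed
  then have "(\<Union>\<alpha>\<in>{\<alpha>. \<exists>u. u \<noteq> 0 \<and> (\<forall>x. ext_prod P x u = vscale (\<alpha> x) u)}. rep.gen_space \<alpha>)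
      \<subseteq> (\<Union>\<alpha>. gen_weight_space P \<alpha>)"
    by blast
  from fv.span_mono[OF this] show ?thesis
    using rep.submodule_subset_span_gen_spaces[of UNIV] by (auto simp: rep.submodule_def)
qed

text \<open>A common null vector over the algebraic closure is turned into one over \<open>K\<close> by a
  \<open>K\<close>-linear functional on the closure.\<close>

lemma zero_notin_weights:
  assumes "H0 P = {vzero}"
  shows "0 \<notin> weights P"
proof
  assume "0 \<in> weights P"
  then have "rep.gen_space (lin_form_app 0) \<noteq> {0}"
    unfolding weights_iff gen_weight_space_eq .
  then obtain v \<alpha> where v: "v \<in> rep.gen_space (lin_form_app 0)" "v \<noteq> 0"
    and \<alpha>: "\<And>x. ext_prod P x v = vscale (\<alpha> x) v"
    using rep.common_eigenvector[OF rep.submodule_gen_space] by metis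
  have null: "ext_prod P x v = 0" for x
  proof -
    have "lin_form_app 0 x = 0" by (simp add: lin_form_app_def zero_fun_apply)
    then obtain k where k: "(rep.shifted x 0 ^^ k) v = 0"
      using v(1) unfolding rep.gen_space_def mem_Collect_eq by metis
    have "(rep.shifted x 0 ^^ k) v = vscale (\<alpha> x ^ k) v" for k
      by (induction k) (simp_all add: rep.shifted_def[of x 0 "vscale _ _"] \<alpha> mult.commute)
    with k v(2) show ?thesis by (simp add: \<alpha>)
  qed
  obtain k where k: "v k \<noteq> 0"
    using v(2) by (auto simp: fun_eq_iff zero_fun_apply)
  have "vector_space (\<lambda>c x. to_ac c * x :: 'a alg_closure)"
    by (simp add: vector_space_def algebra_simps)
  then obtain f :: "'a alg_closure \<Rightarrow> 'a" where f: "\<And>u v. f (u + v) = f u + f v"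
    "\<And>c u. f (to_ac c * u) = c * f u" "f (v k) \<noteq> 0"
    using k by (rule ex_linear_functional) blast
  have f0: "f 0 = 0" using f(2)[of 0 0] by simp
  have f_sum: "f (sum g A) = (\<Sum>i\<in>A. f (g i))" for g and A :: "'n set"
    by (induction A rule: infinite_finite_induct) (simp_all add: f(1) f0)
  \<comment> \<open>The structure constants and the coordinates of \<open>x\<close> lie in K, so
    applying \<open>f\<close> coordinatewise commutes with the action of \<open>x\<close>.\<close>
  have "P x (\<lambda>i. f (v i)) = 0" for x
  proof
    fix j
    have "P x (\<lambda>i. f (v i)) j = f (\<Sum>i\<in>UNIV. \<Sum>l\<in>UNIV.
        to_ac (x i) * (to_ac (P (basis_vec i) (basis_vec l) j) * v l))"
      by (simp add: bilinear_op_expansion[OF bilinear_P, of x] f_sum f(2)) (simp add: mult_ac)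
    also have "\<dots> = f (ext_prod P (emb x) v j)"
      by (simp add: ext_prod_def emb_def mult_ac)
    finally show "P x (\<lambda>i. f (v i)) j = 0 j"
      by (simp add: null zero_fun_apply f0)
  qed
  then have "(\<lambda>i. f (v i)) \<in> H0 P"
    by (simp add: H0_def vzero_eq_0)
  then have "(\<lambda>i. f (v i)) = 0"
    using assms by (simp add: vzero_eq_0)
  then have "f (v k) = 0"
    unfolding fun_eq_iff zero_fun_apply by blast
  then show False using f(3) by simp
qed

text \<open>Derivations give D_(a+b) (uv) = (D_a u) v + u (D_b v) for D_a = L x - a; each
  application consumes a power killing \<open>u\<close> or one killing \<open>v\<close>.\<close>

lemma graded: "lie.graded_subalgebra (gen_weight_space P)"
  unfolding lie.graded_subalgebra_def
proof (intro conjI allI ballI)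
  show "fv.subspace (gen_weight_space P \<alpha>)" for \<alpha>
    by (rule subspace_gen_weight_space)
  fix \<alpha> \<beta> u v
  assume u: "u \<in> gen_weight_space P \<alpha>" and v: "v \<in> gen_weight_space P \<beta>"
  have deriv: "(rep.shifted x (a + b) ^^ (k + l)) (ext_prod N u v) = 0"
    if "(rep.shifted x a ^^ k) u = 0" "(rep.shifted x b ^^ l) v = 0" for x a b k l u v
    using that
  proof (induction "k + l" arbitrary: k l u v)
    case 0
    then show ?case by simp
  next
    case (Suc n)
    show ?case
    proof (cases "k = 0 \<or> l = 0")
      case True
      then show ?thesis using Suc.prems by auto
    next
      case False
      then obtain k' l' where k: "k = Suc k'" "l = Suc l'" by (metis not0_implies_Suc)
      have "(rep.shifted x (a + b) ^^ (k' + l)) (ext_prod N (rep.shifted x a u) v) = 0"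
        using Suc.prems Suc.hyps(2) k by (intro Suc.hyps(1)) (auto simp: funpow_swap1)
      moreover have "(rep.shifted x (a + b) ^^ (k + l')) (ext_prod N u (rep.shifted x b v)) = 0"
        using Suc.prems Suc.hyps(2) k by (intro Suc.hyps(1)) (auto simp: funpow_swap1)
      moreover have "rep.shifted x (a + b) (ext_prod N u v) =
          ext_prod N (rep.shifted x a u) v + ext_prod N u (rep.shifted x b v)"
        by (simp add: rep.shifted_def ext_prod_derivation[OF bilinear_N P] lie.br_diff_right
            lie.br_diff_left fv.scale_left_distrib)
      then have "(rep.shifted x (a + b) ^^ (k + l)) (ext_prod N u v) = (rep.shifted x (a + b) ^^ (k' + l))
          (ext_prod N (rep.shifted x a u) v + ext_prod N u (rep.shifted x b v))"
        using k by (simp only: add_Suc funpow_Suc_right o_apply)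
      moreover have "k' + l = k + l'" using k by simp
      ultimately show ?thesis by simp
    qed
  qed
  show "ext_prod N u v \<in> gen_weight_space P (\<alpha> + \<beta>)"
    unfolding gen_weight_space_eq rep.gen_space_def mem_Collect_eq lin_form_app_add
  proof
    fix x
    obtain k l where "(rep.shifted x (lin_form_app \<alpha> x) ^^ k) u = 0"
      "(rep.shifted x (lin_form_app \<beta> x) ^^ l) v = 0"
      using u v unfolding gen_weight_space_eq rep.gen_space_def by blast
    then show "\<exists>k. (rep.shifted x (lin_form_app \<alpha> x + lin_form_app \<beta> x) ^^ k) (ext_prod N u v) = 0"
      using deriv by blast
  qed
qed

text \<open>Nested brackets are multilinear and weight vectors span, so vanishing need only be
  tested on homogeneous factors, listed with their weights for \<open>foldr_br_eq_0\<close>.\<close>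

lemma lcs_subset_products:
  "lcs (ext_prod N) k \<subseteq> fv.span {foldr (ext_prod N) (map snd ps) v |ps v \<alpha>.
     (\<forall>p\<in>set ps. snd p \<in> gen_weight_space P (fst p)) \<and> length ps = k \<and> v \<in> gen_weight_space P \<alpha>}"
  (is "_ \<subseteq> fv.span (?S k)")
proof (induction k)
  case 0
  have "(\<Union>\<alpha>. gen_weight_space P \<alpha>) \<subseteq> ?S 0" by fastforce
  from fv.span_mono[OF this] show ?case by (simp only: span_gen_weight_spaces lcs.simps)
next
  case (Suc k)
  have "ext_prod N x y \<in> fv.span (?S (Suc k))" if y: "y \<in> lcs (ext_prod N) k" for x y
  proof (rule lie.br_span_left[where A = "\<Union>\<alpha>. gen_weight_space P \<alpha>"])
    fix e
    assume "e \<in> (\<Union>\<alpha>. gen_weight_space P \<alpha>)"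
    then obtain \<beta> where e: "e \<in> gen_weight_space P \<beta>" by blast
    show "ext_prod N e y \<in> fv.span (?S (Suc k))"
    proof (rule lie.br_span_right[OF subsetD[OF Suc.IH y]])
      fix w
      assume "w \<in> ?S k"
      then obtain ps v \<alpha> where w: "w = foldr (ext_prod N) (map snd ps) v"
        "\<forall>p\<in>set ps. snd p \<in> gen_weight_space P (fst p)" "length ps = k" "v \<in> gen_weight_space P \<alpha>"
        by blast
      have "ext_prod N e w = foldr (ext_prod N) (map snd ((\<beta>, e) # ps)) v"
        by (simp add: w(1))
      moreover have "\<forall>p\<in>set ((\<beta>, e) # ps). snd p \<in> gen_weight_space P (fst p)"
        "length ((\<beta>, e) # ps) = Suc k"
        using w e by auto
      ultimately show "ext_prod N e w \<in> fv.span (?S (Suc k))"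
        using w(4) by (intro fv.span_base) blast
    qed simp
  qed (simp_all add: span_gen_weight_spaces)
  then show ?case
    unfolding lcs.simps(2)[of "ext_prod N"] lspan_eq_span by (intro fv.span_minimal) auto
qed

theorem nilpotency_class_bound:
  assumes "H0 P = {vzero}"
  shows "nilpotency_class_le N (card (weights P) ^ (2 ^ card (weights P)))"
proof -
  let ?Y = "weights P" and ?F = "gen_weight_space P"
  have Y0: "0 \<notin> ?Y" by (rule zero_notin_weights[OF assms])
  \<comment> \<open>Including differences makes \<open>\<phi>\<close>, and with it
    \<open>key\<close>, separate distinct weights.\<close>
  define D where "D = (\<lambda>(\<alpha>, \<beta>). \<alpha> - \<beta>) ` (?Y \<times> ?Y) - {0}"
  have "finite (?Y \<union> D)" "0 \<notin> ?Y \<union> D"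
    using finite_weights Y0 by (auto simp: D_def)
  from ex_additive_nonvanishing[OF this] obtain \<phi> :: "('n \<Rightarrow> 'a alg_closure) \<Rightarrow> rat"
    where \<phi>: "\<And>u v. \<phi> (u + v) = \<phi> u + \<phi> v" and \<phi>Y: "\<And>x. x \<in> ?Y \<Longrightarrow> \<phi> x \<noteq> 0"
      and \<phi>D: "\<And>x. x \<in> D \<Longrightarrow> \<phi> x \<noteq> 0"
    by blast
  define key where "key x = - inverse (\<phi> x)" for x
  have inj: "inj_on key ?Y"
  proof (rule inj_onI, rule ccontr)
    fix x y
    assume xy: "x \<in> ?Y" "y \<in> ?Y" "key x = key y" "x \<noteq> y"
    then have "x - y \<in> D" unfolding D_def by force
    moreover have "\<phi> x = \<phi> (x - y) + \<phi> y" using \<phi>[of "x - y" y] by simp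
    ultimately show False using \<phi>D xy(3) by (simp add: key_def)
  qed
  have key: "key (a + b) < key a" if "a \<in> ?Y" "b \<in> ?Y" "a + b \<in> ?Y" "key (a + b) < key b" for a b
    using neg_inverse_order[of "\<phi> a" "\<phi> b"] that \<phi>Y[OF that(1)] \<phi>Y[OF that(2)] \<phi>Y[OF that(3)]
    unfolding key_def \<phi> by blast
  have supp: "?F \<alpha> = {0}" if "\<alpha> \<notin> ?Y" for \<alpha>
    using that by (simp add: weights_iff)
  have zero: "(lie.derived ^^ (2 ^ card ?Y - 1)) ?F \<alpha> = {0}" for \<alpha>
    by (rule lie.derived_pow_trivial[OF finite_weights Y0 inj key graded supp])
  \<comment> \<open>\<open>foldr_br_eq_0\<close> ties the number of operators to the number of
    derived steps; one extra step turns 2^|Y| - 1 into the exponent of the claim.\<close>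
  have Suc: "(lie.derived ^^ (2 ^ card ?Y)) ?F = lie.derived ((lie.derived ^^ (2 ^ card ?Y - 1)) ?F)"
  proof -
    have "(lie.derived ^^ Suc n) ?F = lie.derived ((lie.derived ^^ n) ?F)" for n
      by simp
    from this[of "2 ^ card ?Y - 1"] show ?thesis by (simp del: funpow.simps)
  qed
  have derived0: "(lie.derived ^^ (2 ^ card ?Y)) ?F \<alpha> = {0}" for \<alpha>
  proof
    show "(lie.derived ^^ (2 ^ card ?Y)) ?F \<alpha> \<subseteq> {0}"
      unfolding Suc zero[of \<alpha>, symmetric]
      by (rule lie.derived_subset[OF lie.graded_subalgebra_derived_pow[OF graded]])
    show "{0} \<subseteq> (lie.derived ^^ (2 ^ card ?Y)) ?F \<alpha>"
      using fv.subspace_0[OF lie.graded_subalgebraD(1)[OF lie.graded_subalgebra_derived_pow[OF graded]]]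
      by blast
  qed
  define k where "k = card ?Y ^ (2 ^ card ?Y)"
  have "foldr (ext_prod N) (map snd ps) v = 0"
    if "\<forall>p\<in>set ps. snd p \<in> ?F (fst p)" "length ps = k" "v \<in> ?F \<alpha>" for ps v \<alpha>
    using that derived0 unfolding k_def
    by (intro lie.foldr_br_eq_0[OF \<phi> \<phi>Y finite_weights supp graded graded order_refl]) auto
  then have "lcs (ext_prod N) k \<subseteq> {0}"
    by (intro subset_trans[OF lcs_subset_products fv.span_minimal]) auto
  then have "emb v = 0" if "v \<in> lcs N k" for v
    using emb_lcs[OF bilinear_N that] by blast
  then have "lcs N k \<subseteq> {0}" by auto
  then show ?thesis
    using zero_mem_lcs[of N k] unfolding nilpotency_class_le_def k_def vzero_eq_0 by blast
qed

end

theorem theorem3p3: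
  fixes G N P :: "('n::finite \<Rightarrow> 'a::field_char_0) \<Rightarrow> ('n \<Rightarrow> 'a) \<Rightarrow> ('n \<Rightarrow> 'a)"
  assumes "lie_algebra G" and "lie_algebra N"
    and "post_lie_structure G N P"
    and "nilpotent_lie G"
    and "H0 P = {vzero}"
  shows "nilpotency_class_le N (card (weights P) ^ (2 ^ card (weights P)))"
proof -
  obtain c where "lcs G c = {vzero}"
    using assms(4) by (auto simp: nilpotent_lie_def)
  then interpret pa_structure G N P c
    using assms by unfold_locales
  show ?thesis by (rule nilpotency_class_bound[OF assms(5)])
qed

end
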